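(* Let $\mathbb{F}\in\{\mathbb{R},\mathbb{C},\mathbb{H}\}$. Equip $GL(n)=GL(n,\mathbb{F})$ with the left-invariant metric $\langle A,B\rangle_M=\operatorname{Re}\operatorname{Tr}\big(M^{-1}A(M^{-1}B)^*\big)$, and let $U(n)\times U(n)$ act by $(U,V):M\mapsto UMV^*$. On the open subset of matrices in $GL(n)$ with pairwise distinct singular values, the quotient map $\phi:GL(n)\to GL(n)/(U(n)\times U(n))$ is a Riemannian submersion. The quotient space is parametrised by a single chart, the Weyl chamber $\mathcal{W}$ of diagonal matrices $\Sigma=\operatorname{diag}(\sigma_1,\dots,\sigma_n)$ with $\sigma_1>\cdots>\sigma_n>0$, on which the metric at $\Sigma\in\mathcal{W}$ is $$\langle\dot\Sigma_1,\dot\Sigma_2\rangle_\Sigma=\operatorname{Tr}\Sigma^{-1}\dot\Sigma_1\dot\Sigma_2\Sigma^{-1}$$ for tangent vectors (real diagonal matrices) $\dot\Sigma_1,\dot\Sigma_2$.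
   Context: $\mathbb{H}$ denotes the quaternions. $A^*$ is the (conjugate) transpose over $\mathbb{F}$, and $U(n)=U(n,\mathbb{F})$ is the group of $n\times n$ matrices over $\mathbb{F}$ with $UU^*=I$. The chart sends $\Sigma$ to its $U(n)\times U(n)$-orbit, i.e. an orbit is labelled by its singular values. The quotient carries the natural quotient metric. *)

theory Defs
  imports "HOL-Analysis.Analysis"
begin

section \<open>Quaternions\<close>

datatype quat = Quat (QRe: real) (QI: real) (QJ: real) (QK: real)

lemma quat_eq_iff: "x = y \<longleftrightarrow> QRe x = QRe y \<and> QI x = QI y \<and> QJ x = QJ y \<and> QK x = QK y"
  by (cases x; cases y) simp

instantiation quat :: ab_group_add
begin

definition "0 = Quat 0 0 0 0"
definition "x + y = Quat (QRe x + QRe y) (QI x + QI y) (QJ x + QJ y) (QK x + QK y)"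
definition "- x = Quat (- QRe x) (- QI x) (- QJ x) (- QK x)"
definition "x - y = Quat (QRe x - QRe y) (QI x - QI y) (QJ x - QJ y) (QK x - QK y)"

instance
  by standard (simp_all add: zero_quat_def plus_quat_def uminus_quat_def minus_quat_def)

end

lemma quat_group_sel [simp]:
  "QRe 0 = 0" "QI 0 = 0" "QJ 0 = 0" "QK 0 = 0"
  "QRe (x + y) = QRe x + QRe y" "QI (x + y) = QI x + QI y"
  "QJ (x + y) = QJ x + QJ y" "QK (x + y) = QK x + QK y"
  "QRe (- x) = - QRe x" "QI (- x) = - QI x" "QJ (- x) = - QJ x" "QK (- x) = - QK x"
  "QRe (x - y) = QRe x - QRe y" "QI (x - y) = QI x - QI y"
  "QJ (x - y) = QJ x - QJ y" "QK (x - y) = QK x - QK y"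
  by (simp_all add: zero_quat_def plus_quat_def uminus_quat_def minus_quat_def)

instantiation quat :: real_vector
begin

definition "scaleR r x = Quat (r * QRe x) (r * QI x) (r * QJ x) (r * QK x)"

instance
  by standard (simp_all add: quat_eq_iff scaleR_quat_def algebra_simps)

end

lemma quat_scaleR_sel [simp]:
  "QRe (r *\<^sub>R x) = r * QRe x" "QI (r *\<^sub>R x) = r * QI x"
  "QJ (r *\<^sub>R x) = r * QJ x" "QK (r *\<^sub>R x) = r * QK x"
  by (simp_all add: scaleR_quat_def)

instantiation quat :: real_inner
begin

definition "inner x y = QRe x * QRe y + QI x * QI y + QJ x * QJ y + QK x * QK y"
definition norm_quat_def: "norm (x :: quat) = sqrt (inner x x)"
definition sgn_quat_def: "sgn (x :: quat) = x /\<^sub>R norm x"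
definition dist_quat_def: "dist (x :: quat) y = norm (x - y)"
definition uniformity_quat_def:
  "(uniformity :: (quat \<times> quat) filter) = (INF e\<in>{0 <..}. principal {(x, y). dist x y < e})"
definition open_quat_def:
  "open (U :: quat set) \<longleftrightarrow> (\<forall>x\<in>U. eventually (\<lambda>(x', y). x' = x \<longrightarrow> y \<in> U) uniformity)"

instance
proof
  fix x y z :: quat and a :: real
  show "inner x y = inner y x" "inner (x + y) z = inner x z + inner y z"
       "inner (a *\<^sub>R x) y = a * inner x y" "0 \<le> inner x x"
    by (simp_all add: inner_quat_def algebra_simps)
  have "inner x x = (QRe x)\<^sup>2 + (QI x)\<^sup>2 + (QJ x)\<^sup>2 + (QK x)\<^sup>2"
    by (simp add: inner_quat_def power2_eq_square)
  then show "inner x x = 0 \<longleftrightarrow> x = 0"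
    by (auto simp: quat_eq_iff add_nonneg_eq_0_iff)
qed (rule norm_quat_def sgn_quat_def dist_quat_def open_quat_def uniformity_quat_def)+

end

instantiation quat :: euclidean_space
begin

definition "Basis = {Quat 1 0 0 0, Quat 0 1 0 0, Quat 0 0 1 0, Quat 0 0 0 1}"

instance
proof
  show "(Basis :: quat set) \<noteq> {}" "finite (Basis :: quat set)"
    by (simp_all add: Basis_quat_def)
  show "inner u v = (if u = v then 1 else 0)" if "u \<in> Basis" "v \<in> Basis" for u v :: quat
    using that unfolding Basis_quat_def by (elim insertE emptyE) (simp_all add: inner_quat_def)
  show "(\<forall>u\<in>Basis. inner x u = 0) \<longleftrightarrow> x = 0" for x :: quat
    by (cases x) (simp add: Basis_quat_def inner_quat_def zero_quat_def)
qed

end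

instantiation quat :: real_normed_div_algebra
begin

definition "1 = Quat 1 0 0 0"
definition "x * y = Quat
  (QRe x * QRe y - QI x * QI y - QJ x * QJ y - QK x * QK y)
  (QRe x * QI y + QI x * QRe y + QJ x * QK y - QK x * QJ y)
  (QRe x * QJ y - QI x * QK y + QJ x * QRe y + QK x * QI y)
  (QRe x * QK y + QI x * QJ y - QJ x * QI y + QK x * QRe y)"
definition "inverse x =
  Quat (QRe x / inner x x) (- QI x / inner x x) (- QJ x / inner x x) (- QK x / inner x x)"
definition "x div (y :: quat) = x * inverse y"

instance
proof
  fix x y z :: quat and r :: real
  show "x * y * z = x * (y * z)" "1 * x = x" "x * 1 = x"
       "(x + y) * z = x * z + y * z" "x * (y + z) = x * y + x * z"
       "(0 :: quat) \<noteq> 1"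
    by (simp_all add: quat_eq_iff times_quat_def one_quat_def algebra_simps)
  have scale_left: "r *\<^sub>R x * y = r *\<^sub>R (x * y)"
    and scale_right: "x * r *\<^sub>R y = r *\<^sub>R (x * y)" for r and x y :: quat
    by (simp_all add: quat_eq_iff times_quat_def algebra_simps)
  then show "r *\<^sub>R x * y = r *\<^sub>R (x * y)" "x * r *\<^sub>R y = r *\<^sub>R (x * y)" .
  show "inverse (0 :: quat) = 0" "x div y = x * inverse y"
    by (simp_all add: quat_eq_iff inverse_quat_def divide_quat_def)
  show "inverse x * x = 1" "x * inverse x = 1" if "x \<noteq> 0"
  proof -
    let ?y = "Quat (QRe x) (- QI x) (- QJ x) (- QK x)"
    have inv: "inverse x = (1 / inner x x) *\<^sub>R ?y"
      by (simp add: quat_eq_iff inverse_quat_def)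
    have "inner x x \<noteq> 0" using that by simp
    moreover have "?y * x = inner x x *\<^sub>R 1" "x * ?y = inner x x *\<^sub>R 1"
      by (simp_all add: quat_eq_iff times_quat_def one_quat_def inner_quat_def)
    ultimately show "inverse x * x = 1" "x * inverse x = 1"
      by (simp_all add: inv scale_left scale_right)
  qed
  have "inner (x * y) (x * y) = inner x x * inner y y"
    unfolding inner_quat_def times_quat_def quat.sel by algebra
  then show "norm (x * y) = norm x * norm y"
    by (simp only: norm_quat_def real_sqrt_mult)
qed

end

lemma DIM_quat [simp]: "DIM(quat) = 4"
  by (simp add: Basis_quat_def)


section \<open>The three division algebras\<close>

text \<open>
  The class has, up to isometric isomorphism, exactly the models \<open>\<real>\<close>, \<open>\<complex>\<close> and \<open>\<H>\<close>
  (Frobenius), each with its Euclidean norm and its standard conjugation and real part: the axioms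
  force \<open>re_part x = x \<bullet> 1\<close> and \<open>conjg x = 2 (x \<bullet> 1) - x\<close>. All three are instances.
\<close>

class rch_algebra = real_normed_div_algebra + euclidean_space +
  fixes conjg :: "'a \<Rightarrow> 'a" and re_part :: "'a \<Rightarrow> real"
  assumes add_conjg: "x + conjg x = (2 * re_part x) *\<^sub>R 1"
    and mult_conjg: "x * conjg x = (norm x)\<^sup>2 *\<^sub>R 1"
    and conjg_mult: "conjg (x * y) = conjg y * conjg x"
    and re_part_inner: "re_part (x * conjg y) = inner x y"

instantiation real :: rch_algebra
begin

definition "conjg (x :: real) = x"
definition "re_part (x :: real) = x"

instance
  by standard (simp_all add: conjg_real_def re_part_real_def power2_eq_square)

end

instantiation complex :: rch_algebra
begin

definition "conjg = cnj"
definition "re_part = Re"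

instance
proof
  fix x y :: complex
  show "x + conjg x = (2 * re_part x) *\<^sub>R 1"
    by (rule complex_eqI) (simp_all add: conjg_complex_def re_part_complex_def)
  show "x * conjg x = (norm x)\<^sup>2 *\<^sub>R 1"
    by (rule complex_eqI) (simp_all add: conjg_complex_def cmod_power2, simp add: power2_eq_square)
  show "conjg (x * y) = conjg y * conjg x"
    by (simp add: conjg_complex_def)
  show "re_part (x * conjg y) = inner x y"
    by (simp add: conjg_complex_def re_part_complex_def inner_complex_def)
qed

end

instantiation quat :: rch_algebra
begin

definition "conjg x = Quat (QRe x) (- QI x) (- QJ x) (- QK x)"
definition "re_part = QRe"

instance
proof
  fix x y :: quat
  show "x + conjg x = (2 * re_part x) *\<^sub>R 1"
    by (simp add: quat_eq_iff conjg_quat_def re_part_quat_def one_quat_def)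
  have "(norm x)\<^sup>2 = inner x x" by (simp add: norm_quat_def)
  then show "x * conjg x = (norm x)\<^sup>2 *\<^sub>R 1"
    by (simp add: quat_eq_iff conjg_quat_def one_quat_def times_quat_def inner_quat_def)
  show "conjg (x * y) = conjg y * conjg x"
    by (simp add: quat_eq_iff conjg_quat_def times_quat_def)
  show "re_part (x * conjg y) = inner x y"
    by (simp add: re_part_quat_def conjg_quat_def times_quat_def inner_quat_def)
qed

end


section \<open>Smooth maps and Riemannian submersions\<close>

primrec Ck_on :: "nat \<Rightarrow> 'a::real_normed_vector set \<Rightarrow> ('a \<Rightarrow> 'b::real_normed_vector) \<Rightarrow> bool"
  where
    "Ck_on 0 S f \<longleftrightarrow> continuous_on S f"
  | "Ck_on (Suc k) S f \<longleftrightarrow> (\<forall>x\<in>S. f differentiable (at x)) \<and>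
       (\<forall>v. Ck_on k S (\<lambda>x. frechet_derivative f (at x) v))"

definition smooth_on ::
    "'a::real_normed_vector set \<Rightarrow> ('a \<Rightarrow> 'b::real_normed_vector) \<Rightarrow> bool"
  where "smooth_on S f \<longleftrightarrow> (\<forall>k. Ck_on k S f)"

text \<open>Manifolds are represented by open subsets of Euclidean spaces, with the ambient space as the
  tangent space at each point; a metric \<open>g\<close> assigns to a point \<open>x\<close> the form \<open>g x\<close>.\<close>

type_synonym 'a metric = "'a \<Rightarrow> 'a \<Rightarrow> 'a \<Rightarrow> real"

definition riemannian_metric_on :: "'a::euclidean_space set \<Rightarrow> 'a metric \<Rightarrow> bool"
  where "riemannian_metric_on S g \<longleftrightarrow> open S \<and>
    (\<forall>x\<in>S. bilinear (g x) \<and> (\<forall>u v. g x u v = g x v u) \<and> (\<forall>u. u \<noteq> 0 \<longrightarrow> 0 < g x u u)) \<and>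
    (\<forall>u v. smooth_on S (\<lambda>x. g x u v))"

definition horizontal_space ::
    "'a::euclidean_space metric \<Rightarrow> ('a \<Rightarrow> 'b::euclidean_space) \<Rightarrow> 'a \<Rightarrow> 'a set"
  where "horizontal_space g f x =
    {u. \<forall>w. frechet_derivative f (at x) w = 0 \<longrightarrow> g x u w = 0}"

definition riemannian_submersion ::
    "'a::euclidean_space set \<Rightarrow> 'a metric \<Rightarrow> 'b::euclidean_space set \<Rightarrow> 'b metric \<Rightarrow>
     ('a \<Rightarrow> 'b) \<Rightarrow> bool"
  where "riemannian_submersion S g T h f \<longleftrightarrow>
    riemannian_metric_on S g \<and> riemannian_metric_on T h \<and> f ` S \<subseteq> T \<and> smooth_on S f \<and>
    (\<forall>x\<in>S. surj (frechet_derivative f (at x)) \<and>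
      (\<forall>u\<in>horizontal_space g f x. \<forall>v\<in>horizontal_space g f x.
        h (f x) (frechet_derivative f (at x) u) (frechet_derivative f (at x) v) = g x u v))"

definition horizontal_lift ::
    "'a::euclidean_space metric \<Rightarrow> ('a \<Rightarrow> 'b::euclidean_space) \<Rightarrow> 'a \<Rightarrow> 'b \<Rightarrow> 'a"
  where "horizontal_lift g f x v =
    (THE u. u \<in> horizontal_space g f x \<and> frechet_derivative f (at x) u = v)"

text \<open>The natural metric on the target of \<open>f\<close>: the common value, over all points \<open>x\<close> of the fibre
  of \<open>y\<close>, of the metric of \<open>S\<close> on horizontal lifts. (If the values on the fibre did not agree, it
  would be unspecified.)\<close>

definition quotient_metric ::
    "'a::euclidean_space set \<Rightarrow> 'a metric \<Rightarrow> ('a \<Rightarrow> 'b::euclidean_space) \<Rightarrow> 'b metric"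
  where "quotient_metric S g f y v w =
    (THE r. \<forall>x\<in>S. f x = y \<longrightarrow> r = g x (horizontal_lift g f x v) (horizontal_lift g f x w))"

definition quotient_topology :: "'a::topological_space set \<Rightarrow> ('a \<Rightarrow> 'b) \<Rightarrow> 'b topology"
  where "quotient_topology S p =
    topology (\<lambda>V. V \<subseteq> p ` S \<and> openin (top_of_set S) {x \<in> S. p x \<in> V})"

lemma openin_quotient_topology:
  "openin (quotient_topology S p) V \<longleftrightarrow>
     V \<subseteq> p ` S \<and> openin (top_of_set S) {x \<in> S. p x \<in> V}"
proof -
  have "istopology (\<lambda>V. V \<subseteq> p ` S \<and> openin (top_of_set S) {x \<in> S. p x \<in> V})"
    unfolding istopology_def
  proof (intro conjI allI impI)
    fix U V assume "U \<subseteq> p ` S \<and> openin (top_of_set S) {x \<in> S. p x \<in> U}"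
      and "V \<subseteq> p ` S \<and> openin (top_of_set S) {x \<in> S. p x \<in> V}"
    moreover have "{x \<in> S. p x \<in> U \<inter> V} = {x \<in> S. p x \<in> U} \<inter> {x \<in> S. p x \<in> V}" by auto
    ultimately show "U \<inter> V \<subseteq> p ` S" "openin (top_of_set S) {x \<in> S. p x \<in> U \<inter> V}" by auto
  next
    fix \<K> assume K: "\<forall>K\<in>\<K>. K \<subseteq> p ` S \<and> openin (top_of_set S) {x \<in> S. p x \<in> K}"
    then show "\<Union> \<K> \<subseteq> p ` S" by blast
    have "{x \<in> S. p x \<in> \<Union> \<K>} = (\<Union>K\<in>\<K>. {x \<in> S. p x \<in> K})" by auto
    then show "openin (top_of_set S) {x \<in> S. p x \<in> \<Union> \<K>}" using K by auto
  qed
  then show ?thesis by (simp add: quotient_topology_def)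
qed


section \<open>Matrices, singular values and the action\<close>

definition ctranspose :: "'f::rch_algebra^'n^'m \<Rightarrow> 'f^'m^'n"
  where "ctranspose A = (\<chi> i j. conjg (A $ j $ i))"

definition unitary_group :: "('f::rch_algebra^'n^'n) set"
  where "unitary_group = {U. U ** ctranspose U = mat 1}"

definition diag_mat :: "real^'n \<Rightarrow> 'f::real_algebra_1^'n^'n"
  where "diag_mat \<sigma> = (\<chi> i j. if i = j then of_real (\<sigma> $ i) else 0)"

text \<open>The singular values are the square roots of the eigenvalues of \<open>M\<^sup>* M\<close>, listed with
  multiplicity, in any order. The multiplicity is the dimension over \<open>'f\<close> of the eigenspace, so
  its dimension over \<open>\<real>\<close> is \<open>DIM('f)\<close> times as large; eigenvalues are real, so there is no
  distinction between left and right eigenvalues.\<close>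

definition singular_values :: "'f::rch_algebra^'n^'n \<Rightarrow> real^'n \<Rightarrow> bool"
  where "singular_values M \<sigma> \<longleftrightarrow> (\<forall>i. 0 \<le> \<sigma> $ i) \<and>
    (\<forall>s\<ge>0. dim {v. (ctranspose M ** M) *v v = s\<^sup>2 *\<^sub>R v} = DIM('f) * card {i. \<sigma> $ i = s})"

definition regular_GL :: "('f::rch_algebra^'n^'n) set"
  where "regular_GL = {M. invertible M \<and> (\<exists>\<sigma>. singular_values M \<sigma> \<and> inj (($) \<sigma>))}"

definition GL_metric :: "('f::rch_algebra^'n^'n) metric"
  where "GL_metric M A B =
    re_part (trace (matrix_inv M ** A ** ctranspose (matrix_inv M ** B)))"

definition unitary_orbit :: "'f::rch_algebra^'n^'n \<Rightarrow> ('f^'n^'n) set"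
  where "unitary_orbit M =
    {U ** M ** ctranspose V | U V. U \<in> unitary_group \<and> V \<in> unitary_group}"

text \<open>Real diagonal matrices are represented by their vectors of diagonal entries, so that the Weyl
  chamber is an open subset of \<open>real^'n\<close>; the linear order of the index type \<open>'n\<close> provides the
  numbering \<open>1, \<dots>, n\<close>.\<close>

definition weyl_chamber :: "(real^'n::{finite,linorder}) set"
  where "weyl_chamber = {\<sigma>. (\<forall>i j. i < j \<longrightarrow> \<sigma> $ i > \<sigma> $ j) \<and> (\<forall>i. 0 < \<sigma> $ i)}"

definition weyl_chart :: "real^'n \<Rightarrow> ('f::rch_algebra^'n^'n) set"
  where "weyl_chart \<sigma> = unitary_orbit (diag_mat \<sigma>)"

text \<open>The quotient map \<open>unitary_orbit\<close> read in the chart. The smooth structure of the quotient is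
  the one given by the single chart \<open>weyl_chart\<close>; it is the quotient structure precisely when this
  map is a smooth submersion.\<close>

definition quotient_map_in_chart :: "'f::rch_algebra^'n::{finite,linorder}^'n::{finite,linorder} \<Rightarrow> real^'n::{finite,linorder}"
  where "quotient_map_in_chart M =
    the_inv_into weyl_chamber weyl_chart (unitary_orbit M)"

end

theory Submission
  imports Defs
begin

text \<open>
  Every matrix has a singular value decomposition \<open>M = U \<Sigma> V\<^sup>*\<close>, so the orbits are labelled by the
  singular values; if these are pairwise distinct and positive, there is exactly one label in the
  open Weyl chamber. This makes the chart a bijection, and compactness of the unitary group makes
  it a homeomorphism and \<open>GL\<close> with distinct singular values an open set. What remains is to
  differentiate the singular values.

  The decomposition itself is obtained without determinants or an induction over dimensions, hence
  uniformly for \<open>\<real>\<close>, \<open>\<complex>\<close> and \<open>\<H>\<close>: among all \<open>U D V\<^sup>*\<close> with a fixed diagonal matrix \<open>D\<close> whose entries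
  are positive and strictly decrease, take one that has the largest inner product with \<open>M\<close>. The first order conditions
  say that \<open>N = U\<^sup>* M V\<close> makes both \<open>D N\<close> and \<open>N D\<close> Hermitian, which forces \<open>N\<close> to be diagonal, and
  comparison with unit scalars on the diagonal and with transpositions shows that \<open>N\<close> is nonnegative
  and sorted (\<open>singular_value_decomposition\<close>).

  For the calculus, let \<open>P\<^sub>i\<close> be the orthogonal projection to the \<open>i\<close>-th eigenspace of \<open>H = M\<^sup>* M\<close>, with
  eigenvalue \<open>\<sigma>\<^sub>i\<^sup>2\<close>. For two matrices \<open>x\<close>, \<open>y\<close> one has the exact identity
  \<open>P\<^sub>j(x) (H(y) - H(x)) P\<^sub>i(y) = (\<sigma>\<^sub>i(y)\<^sup>2 - \<sigma>\<^sub>j(x)\<^sup>2) P\<^sub>j(x) P\<^sub>i(y)\<close> (\<open>spectral_proj_increment\<close>). It presents the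
  increments of \<open>P\<^sub>i\<close> and \<open>\<sigma>\<^sub>i\<close> as a linear map, continuous in \<open>y\<close>, applied to \<open>y - x\<close>, so both are
  differentiable in the sense of Caratheodory. The derivatives are rational expressions in the same
  functions, so smoothness follows by bootstrapping (\<open>Ck_on_sv_spectral_proj\<close>).

  The result is \<open>d\<sigma>\<^sub>i(v) = Re Tr(v (M P\<^sub>i)\<^sup>*) / \<sigma>\<^sub>i\<close>. With respect to the left-invariant metric, the
  matrices \<open>M P\<^sub>i\<close> span the orthogonal complement of the kernel, and the lift of \<open>d\<close> is
  \<open>\<Sum>\<^sub>i (d\<^sub>i / \<sigma>\<^sub>i) M P\<^sub>i\<close>. Left translation by \<open>M\<^sup>-\<^sup>1\<close> turns it into \<open>\<Sum>\<^sub>i (d\<^sub>i / \<sigma>\<^sub>i) P\<^sub>i\<close>, and the \<open>P\<^sub>i\<close> are orthonormal,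
  so that the metric on lifts is \<open>\<Sum>\<^sub>i d\<^sub>i d'\<^sub>i / \<sigma>\<^sub>i\<^sup>2\<close>, which depends on the singular values only
  (\<open>GL_metric_lift\<close>).
\<close>

section \<open>Conjugation, adjoints and diagonal matrices\<close>

text \<open>The index types of square matrices have to be ordered for the Weyl chamber; the synonym keeps that
  constraint from being repeated for rows and columns.\<close>

type_synonym ('f, 'n) sqmat = "(('f, 'n) vec, 'n) vec"

lemma conjg_one [simp]: "conjg (1::'f::rch_algebra) = 1"
  using mult_conjg[of "1::'f"] by simp

lemma re_part_eq_inner: "re_part (x::'f::rch_algebra) = inner x 1"
  using re_part_inner[of x 1] by simp

text \<open>The axioms determine the conjugation as the reflection in the line of the reals. It is therefore
  linear, involutive and isometric.\<close>

lemma conjg_eq: "conjg (x::'f::rch_algebra) = (2 * inner x 1) *\<^sub>R 1 - x"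
  using add_conjg[of x] by (simp add: re_part_eq_inner algebra_simps)

lemma inner_one_one [simp]: "inner (1::'f::rch_algebra) 1 = 1"
  by (simp add: dot_square_norm)

lemma conjg_conjg [simp]: "conjg (conjg x) = (x::'f::rch_algebra)"
  by (simp add: conjg_eq inner_diff_left algebra_simps)

lemma linear_conjg: "linear (conjg :: 'f::rch_algebra \<Rightarrow> 'f)"
  by (rule linearI) (simp_all add: conjg_eq inner_add_left algebra_simps)

lemma conjg_of_real [simp]: "conjg (of_real r :: 'f::rch_algebra) = of_real r"
  by (simp add: of_real_def linear_scale[OF linear_conjg])

lemma conjg_zero [simp]: "conjg (0 :: 'f::rch_algebra) = 0"
  by (rule linear_0[OF linear_conjg])

lemma inner_conjg: "inner (conjg x) (conjg y) = inner (x::'f::rch_algebra) y"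
  by (simp add: conjg_eq inner_diff_left inner_diff_right inner_commute[of 1 y] algebra_simps)

lemma conjg_mult_self: "norm a = 1 \<Longrightarrow> conjg a * a = (1::'f::rch_algebra)"
  using mult_conjg[of "conjg a"] inner_conjg[of a a] by (simp add: norm_eq_sqrt_inner)

lemma mult_conjg_self: "norm a = 1 \<Longrightarrow> a * conjg a = (1::'f::rch_algebra)"
  using mult_conjg[of a] by simp

text \<open>Right multiplication by a scalar, and below by a matrix, has right multiplication by the conjugate
  as its adjoint. These adjunctions replace the cyclicity of the trace, which fails over a
  noncommutative algebra.\<close>

lemma inner_mult_right_adj: "inner (x * y) (z::'f::rch_algebra) = inner x (z * conjg y)"
  using re_part_inner[of "x*y" z] re_part_inner[of x "z * conjg y"] by (simp add: conjg_mult mult.assoc)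

lemma bounded_bilinear_matrix_mult:
  "bounded_bilinear ((**) :: 'f::rch_algebra^'n^'m \<Rightarrow> 'f^'p^'n \<Rightarrow> 'f^'p^'m)"
proof -
  have "bilinear ((**) :: 'f::rch_algebra^'n^'m \<Rightarrow> 'f^'p^'n \<Rightarrow> 'f^'p^'m)"
    unfolding bilinear_def
    by (auto intro!: linearI
      simp: matrix_matrix_mult_def vec_eq_iff algebra_simps sum.distrib scaleR_sum_right)
  then show ?thesis by (simp add: bilinear_conv_bounded_bilinear)
qed

interpretation matmul: bounded_bilinear "(**) :: 'f::rch_algebra^'n^'m \<Rightarrow> 'f^'p^'n \<Rightarrow> 'f^'p^'m"
  by (rule bounded_bilinear_matrix_mult)

lemma linear_ctranspose: "linear (ctranspose :: 'f::rch_algebra^'n^'m \<Rightarrow> 'f^'m^'n)"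
  by (rule linearI) (simp_all add: ctranspose_def vec_eq_iff linear_add[OF linear_conjg] linear_scale[OF linear_conjg])

lemma bounded_linear_ctranspose: "bounded_linear (ctranspose :: 'f::rch_algebra^'n^'m \<Rightarrow> 'f^'m^'n)"
  using linear_ctranspose linear_conv_bounded_linear by blast

lemma ctranspose_mult: "ctranspose (A ** B) = ctranspose B ** ctranspose (A::'f::rch_algebra^'n^'m)"
  by (simp add: ctranspose_def matrix_matrix_mult_def vec_eq_iff linear_sum[OF linear_conjg] conjg_mult)

lemma ctranspose_ctranspose [simp]: "ctranspose (ctranspose A) = (A::'f::rch_algebra^'n^'m)"
  by (simp add: ctranspose_def vec_eq_iff)

lemma ctranspose_one [simp]: "ctranspose (mat 1) = (mat 1::'f::rch_algebra^'n^'n)"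
  by (simp add: ctranspose_def mat_def vec_eq_iff)

lemma inner_ctranspose: "inner (ctranspose A) (ctranspose B) = inner (A::'f::rch_algebra^'n^'m) B"
  unfolding ctranspose_def inner_vec_def vec_lambda_beta inner_conjg by (rule sum.swap)

lemma inner_matrix_mult_right: "inner (A ** B) C = inner A (C ** ctranspose (B::'f::rch_algebra^'n^'m))"
proof -
  have "inner (A ** B) C = (\<Sum>i\<in>UNIV. \<Sum>j\<in>UNIV. \<Sum>k\<in>UNIV. inner (A$i$k) (C$i$j * conjg (B$k$j)))"
    by (simp add: inner_vec_def matrix_matrix_mult_def inner_sum_left inner_mult_right_adj)
  also have "\<dots> = (\<Sum>i\<in>UNIV. \<Sum>k\<in>UNIV. \<Sum>j\<in>UNIV. inner (A$i$k) (C$i$j * conjg (B$k$j)))"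
    by (rule sum.cong[OF refl], rule sum.swap)
  also have "\<dots> = inner A (C ** ctranspose B)"
    by (simp add: inner_vec_def matrix_matrix_mult_def inner_sum_right ctranspose_def)
  finally show ?thesis .
qed

lemma inner_matrix_mult_left: "inner (A ** B) C = inner B (ctranspose (A::'f::rch_algebra^'n^'m) ** C)"
  using inner_matrix_mult_right[of "ctranspose B" "ctranspose A" "ctranspose C"]
  by (metis ctranspose_ctranspose ctranspose_mult inner_ctranspose)

lemma inner_sandwich:
  fixes A :: "'f::rch_algebra^'n^'m" and X :: "'f^'p^'n" and B :: "'f^'p^'q"
  shows "inner (A ** X ** ctranspose B) M = inner X (ctranspose A ** M ** B)"
  by (simp add: inner_matrix_mult_right[of "A ** X"] inner_matrix_mult_left[of A X] matrix_mul_assoc)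

lemma re_part_trace: "re_part (trace (A ** ctranspose B)) = inner A (B::'f::rch_algebra^'n^'m)"
  by (simp add: trace_def ctranspose_def matrix_matrix_mult_def inner_vec_def
     re_part_eq_inner inner_sum_left inner_mult_right_adj)

lemma GL_metric_eq: "GL_metric M A B = inner (matrix_inv M ** A) (matrix_inv M ** B)"
  by (simp add: GL_metric_def re_part_trace)

lemma matrix_inv_eqI:
  fixes A B :: "'f::rch_algebra^'n^'n"
  assumes "A ** B = mat 1" "B ** A = mat 1"
  shows "matrix_inv A = B"
proof -
  have "A ** matrix_inv A = mat 1 \<and> matrix_inv A ** A = mat 1"
    unfolding matrix_inv_def by (rule someI[of _ B]) (simp add: assms)
  then have "matrix_inv A = (B ** A) ** matrix_inv A" "(B ** A) ** matrix_inv A = B"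
    by (simp add: assms(2), simp add: matrix_mul_assoc[symmetric])
  then show ?thesis by simp
qed

text \<open>Determinants are not available over a noncommutative algebra. Instead, a right inverse makes the
  real-linear map \<open>v \<mapsto> B v\<close> injective, hence surjective by dimension count.\<close>

lemma matrix_left_inverse_if_right_inverse:
  fixes A B :: "'f::rch_algebra^'n^'n"
  assumes "A ** B = mat 1"
  shows "B ** A = mat 1"
proof -
  have "inj ((*v) B)"
    by (rule inj_on_inverseI[of _ "(*v) A"]) (simp add: matrix_vector_mul_assoc assms)
  moreover have "linear ((*v) B)" by simp
  ultimately have "surj ((*v) B)" by (rule linear_inj_imp_surj[rotated])
  moreover have "(B ** A) *v (B *v v) = B *v v" for v
    by (simp add: matrix_vector_mul_assoc matrix_mul_assoc[symmetric] assms)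
  ultimately have "\<forall>w. (B ** A) *v w = w" by (metis surjD)
  then show ?thesis by (simp add: matrix_eq)
qed

lemma diag_mat_nth: "diag_mat \<sigma> $ i $ j = (if i = j then of_real (\<sigma> $ i) else 0)"
  by (simp add: diag_mat_def)

lemma diag_mat_mult_nth: "(diag_mat \<sigma> ** A) $ i $ j = \<sigma> $ i *\<^sub>R (A::'f::rch_algebra^'m^'n) $ i $ j"
  by (simp add: diag_mat_def matrix_matrix_mult_def if_distrib if_distribR of_real_def cong: if_cong)

lemma mult_diag_mat_nth: "((A::'f::rch_algebra^'n^'m) ** diag_mat \<sigma>) $ i $ j = \<sigma> $ j *\<^sub>R A $ i $ j"
  by (simp add: diag_mat_def matrix_matrix_mult_def if_distrib if_distribR of_real_def cong: if_cong)

lemma diag_mat_mult_vec_nth: "(diag_mat \<sigma> *v v) $ i = \<sigma> $ i *\<^sub>R (v::'f::rch_algebra^'n) $ i"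
  by (simp add: diag_mat_def matrix_vector_mult_def if_distrib if_distribR of_real_def cong: if_cong)

lemma diag_mat_mult: "diag_mat \<sigma> ** diag_mat \<tau> = (diag_mat (\<chi> i. \<sigma> $ i * \<tau> $ i) :: 'f::rch_algebra^'n^'n)"
  by (simp add: vec_eq_iff diag_mat_mult_nth diag_mat_nth of_real_def)

lemma ctranspose_diag_mat [simp]: "ctranspose (diag_mat \<sigma>) = (diag_mat \<sigma> :: 'f::rch_algebra^'n^'n)"
  by (simp add: vec_eq_iff ctranspose_def diag_mat_nth)

lemma linear_diag_mat: "linear (diag_mat :: real^'n \<Rightarrow> 'f::rch_algebra^'n^'n)"
  by (rule linearI) (simp_all add: diag_mat_def vec_eq_iff of_real_def algebra_simps)

lemma bounded_linear_diag_mat: "bounded_linear (diag_mat :: real^'n \<Rightarrow> 'f::rch_algebra^'n^'n)"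
  using linear_diag_mat linear_conv_bounded_linear by blast

lemma diag_mat_one: "diag_mat (\<chi> i. 1) = (mat 1 :: 'f::rch_algebra^'n^'n)"
  by (simp add: diag_mat_def mat_def vec_eq_iff)

lemma inner_diag_mat: "inner (diag_mat \<sigma>) (diag_mat \<tau> :: 'f::rch_algebra^'n^'n) = inner \<sigma> \<tau>"
  by (simp add: inner_vec_def diag_mat_def if_distrib if_distribR of_real_def mult.commute cong: if_cong)

section \<open>The unitary group\<close>

lemma unitary_groupD:
  assumes "U \<in> unitary_group"
  shows "U ** ctranspose U = mat 1" "ctranspose U ** U = (mat 1 :: 'f::rch_algebra^'n^'n)"
  using assms matrix_left_inverse_if_right_inverse by (auto simp: unitary_group_def)

lemma unitary_cancel:
  assumes "U \<in> unitary_group"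
  shows "U ** (ctranspose U ** A) = A" "ctranspose U ** (U ** A) = (A :: 'f::rch_algebra^'n^'n)"
  by (simp_all add: matrix_mul_assoc unitary_groupD[OF assms])

lemma unitary_mult:
  assumes "U \<in> unitary_group" "V \<in> unitary_group"
  shows "U ** V \<in> unitary_group"
proof -
  have "(U ** V) ** ctranspose (U ** V) = mat 1"
    using assms by (simp add: ctranspose_mult matrix_mul_assoc[symmetric] unitary_cancel unitary_groupD)
  then show ?thesis by (simp add: unitary_group_def)
qed

lemma unitary_ctranspose: "U \<in> unitary_group \<Longrightarrow> ctranspose U \<in> unitary_group"
  using unitary_groupD(2)[of U] by (simp add: unitary_group_def)

lemma unitary_one: "mat 1 \<in> unitary_group"
  by (simp add: unitary_group_def)

text \<open>All unitary matrices have the norm of the identity matrix.\<close>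

lemma compact_unitary_group: "compact (unitary_group :: ('f::rch_algebra^'n^'n) set)"
proof -
  have "closed (unitary_group :: ('f^'n^'n) set)"
    unfolding unitary_group_def
    by (intro closed_Collect_eq matmul.continuous_on bounded_linear.continuous_on[OF bounded_linear_ctranspose]
        continuous_on_id continuous_on_const)
  moreover have "norm U = norm (mat 1 :: 'f^'n^'n)" if "U \<in> unitary_group" for U :: "'f^'n^'n"
    using inner_matrix_mult_right[of "mat 1" U U] unitary_groupD[OF that] by (simp add: norm_eq_sqrt_inner)
  then have "bounded (unitary_group :: ('f^'n^'n) set)"
    by (intro boundedI[of _ "norm (mat 1 :: 'f^'n^'n)"]) simp
  ultimately show ?thesis by (simp add: compact_eq_bounded_closed)
qed

section \<open>Existence of singular value decompositions\<close>

definition elem_mat :: "'n \<Rightarrow> 'n \<Rightarrow> 'f::rch_algebra \<Rightarrow> 'f^'n^'n"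
  where "elem_mat i j a = axis i (axis j a)"

lemma elem_mat_nth: "elem_mat i j a $ r $ s = (if r = i \<and> s = j then a else 0)"
  by (simp add: elem_mat_def axis_def)

lemma elem_mat_mult:
  "elem_mat i j a ** elem_mat k l b = (if j = k then elem_mat i l (a * b) else 0 :: 'f::rch_algebra^'n^'n)"
proof -
  have "(elem_mat i j a ** elem_mat k l b :: 'f^'n^'n) $ r $ s
      = (if j = k then elem_mat i l (a * b) else 0) $ r $ s" for r s
  proof -
    have "(elem_mat i j a ** elem_mat k l b :: 'f^'n^'n) $ r $ s
        = (\<Sum>q\<in>UNIV. if q = j then (if j = k \<and> r = i \<and> s = l then a * b else 0) else 0)"
      unfolding matrix_matrix_mult_def vec_lambda_beta
      by (rule sum.cong) (simp_all add: elem_mat_nth)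
    then show ?thesis by (simp add: elem_mat_nth)
  qed
  then show ?thesis by (simp add: vec_eq_iff)
qed

lemma ctranspose_elem_mat: "ctranspose (elem_mat i j a) = (elem_mat j i (conjg a) :: 'f::rch_algebra^'n^'n)"
  by (auto simp: vec_eq_iff ctranspose_def elem_mat_nth)

lemma inner_elem_mat: "inner (elem_mat i j a) A = inner a ((A::'f::rch_algebra^'n^'n) $ i $ j)"
  by (simp add: elem_mat_def inner_axis')

text \<open>Rodrigues' formula: \<open>X\<^sup>3 = - X\<close> turns the exponential of \<open>t X\<close> into this expression, so that a
  one-parameter group of unitary matrices is available without matrix exponentials.\<close>

lemma skew_cube_rotation_unitary:
  fixes X :: "'f::rch_algebra^'n^'n" and t :: real
  assumes skew: "ctranspose X = - X" and cube: "X ** (X ** X) = - X"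
  shows "mat 1 + sin t *\<^sub>R X + (1 - cos t) *\<^sub>R (X ** X) \<in> unitary_group"
proof -
  define s c where "s = sin t" and "c = 1 - cos t"
  define Y where "Y = X ** X"
  have Y: "ctranspose Y = Y"
    by (simp add: Y_def ctranspose_mult skew matmul.minus_left matmul.minus_right)
  have prods: "X ** X = Y" "X ** Y = - X" "Y ** X = - X" "Y ** Y = - Y"
    using cube by (simp_all add: Y_def matrix_mul_assoc[symmetric] matmul.minus_right)
  have "(mat 1 + s *\<^sub>R X + c *\<^sub>R Y) ** ctranspose (mat 1 + s *\<^sub>R X + c *\<^sub>R Y)
      = (mat 1 + s *\<^sub>R X + c *\<^sub>R Y) ** (mat 1 - s *\<^sub>R X + c *\<^sub>R Y)"
    by (simp add: linear_add[OF linear_ctranspose] linear_scale[OF linear_ctranspose] Y skew)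
  also have "\<dots> = mat 1 + (c *\<^sub>R Y + c *\<^sub>R Y - (s * s) *\<^sub>R Y - (c * c) *\<^sub>R Y)"
    by (simp add: matmul.add_left matmul.add_right matmul.diff_left matmul.diff_right
        matmul.scaleR_left matmul.scaleR_right prods scaleR_right_distrib scaleR_right_diff_distrib)
  also have "\<dots> = mat 1 + (c + c - s * s - c * c) *\<^sub>R Y"
    by (simp only: scaleR_left_distrib scaleR_left_diff_distrib)
  also have "c + c - s * s - c * c = 0"
    using sin_cos_squared_add[of t] by (simp add: s_def c_def power2_eq_square algebra_simps)
  finally show ?thesis by (simp add: unitary_group_def Y_def s_def c_def)
qed

text \<open>The expression vanishes at \<open>t = 0\<close>, so it has a maximum there, and its derivative is \<open>p\<close>.\<close>

lemma linear_coeff_zero_if_rotation_max: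
  fixes p q :: real
  assumes "\<And>t. sin t * p + (1 - cos t) * q \<le> 0"
  shows "p = 0"
proof -
  have "((\<lambda>t. sin t * p + (1 - cos t) * q) has_real_derivative p) (at 0)"
    by (auto intro!: derivative_eq_intros)
  from DERIV_local_max[OF this, of 1] show ?thesis using assms by simp
qed

text \<open>The first order condition at the identity along rotations of the plane of the \<open>i\<close>-th and \<open>j\<close>-th
  coordinates. The coefficient \<open>a\<close> of the generator is an arbitrary unit scalar; it is chosen in the
  direction of the supposed difference.\<close>

lemma entry_if_identity_maximizes:
  fixes A :: "'f::rch_algebra^'n^'n"
  assumes max: "\<And>W. W \<in> unitary_group \<Longrightarrow> inner W A \<le> inner (mat 1) A"
    and "i \<noteq> j"
  shows "A $ i $ j = conjg (A $ j $ i)"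
proof (rule ccontr)
  define b where "b = A $ i $ j - conjg (A $ j $ i)"
  define a where "a = sgn b"
  assume "A $ i $ j \<noteq> conjg (A $ j $ i)"
  then have b: "b \<noteq> 0" by (simp add: b_def)
  then have a: "norm a = 1" by (simp add: a_def norm_sgn)
  define X where "X = elem_mat i j a - elem_mat j i (conjg a)"
  have sq: "X ** X = - (elem_mat i i 1 + elem_mat j j 1)"
    using \<open>i \<noteq> j\<close> a
    by (simp add: X_def matmul.diff_left matmul.diff_right elem_mat_mult mult_conjg_self conjg_mult_self)
  have "X ** (X ** X) = - X"
    unfolding sq using \<open>i \<noteq> j\<close>
    by (simp add: X_def matmul.diff_left matmul.diff_right matmul.minus_right matmul.add_right elem_mat_mult)
  moreover have "ctranspose X = - X"
    by (simp add: X_def linear_diff[OF linear_ctranspose] ctranspose_elem_mat)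
  ultimately have "mat 1 + sin t *\<^sub>R X + (1 - cos t) *\<^sub>R (X ** X) \<in> unitary_group" for t
    by (intro skew_cube_rotation_unitary)
  from max[OF this] have "sin t * inner X A + (1 - cos t) * inner (X ** X) A \<le> 0" for t
    by (simp add: inner_add_left)
  then have "inner X A = 0" by (rule linear_coeff_zero_if_rotation_max)
  moreover have "inner X A = inner a b"
    using inner_conjg[of a "conjg (A $ j $ i)"]
    by (simp add: X_def b_def inner_diff_left inner_diff_right inner_elem_mat)
  ultimately show False using b by (simp add: a_def sgn_div_norm)
qed

text \<open>Competitors that differ from the identity in one diagonal entry. The unit scalar \<open>a\<close> in direction of
  the entry gives the inner product \<open>norm (A $ i $ i)\<close>, and \<open>1\<close> can only match this in the equality
  case of the Cauchy-Schwarz inequality.\<close>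

lemma diag_entry_if_identity_maximizes:
  fixes A :: "'f::rch_algebra^'n^'n"
  assumes max: "\<And>W. W \<in> unitary_group \<Longrightarrow> inner W A \<le> inner (mat 1) A"
  shows "A $ i $ i = of_real (norm (A $ i $ i))"
proof (cases "A $ i $ i = 0")
  case False
  define a where "a = sgn (A $ i $ i)"
  have a: "norm a = 1" using False by (simp add: a_def norm_sgn)
  define W where "W = mat 1 + elem_mat i i (a - 1)"
  have "(a - 1) + conjg (a - 1) + (a - 1) * conjg (a - 1) = 0"
    using mult_conjg_self[OF a] by (simp add: linear_diff[OF linear_conjg] algebra_simps)
  then have "elem_mat i i (a - 1) + elem_mat i i (conjg (a - 1)) 
       + elem_mat i i ((a - 1) * conjg (a - 1)) = (0 :: 'f^'n^'n)"
    by (simp add: vec_eq_iff elem_mat_nth)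
  then have "W \<in> unitary_group"
    by (simp add: W_def unitary_group_def linear_add[OF linear_ctranspose] ctranspose_elem_mat
        matmul.add_left matmul.add_right elem_mat_mult add.assoc)
  from max[OF this] have "inner a (A $ i $ i) \<le> inner 1 (A $ i $ i)"
    by (simp add: W_def inner_add_left inner_elem_mat inner_diff_left)
  moreover have "inner a (A $ i $ i) = norm (A $ i $ i)"
    using False by (simp add: a_def sgn_div_norm dot_square_norm power2_eq_square)
  ultimately have "inner 1 (A $ i $ i) = norm (1::'f) * norm (A $ i $ i)"
    using norm_cauchy_schwarz[of 1 "A $ i $ i"] by simp
  then have "norm (1::'f) *\<^sub>R A $ i $ i = norm (A $ i $ i) *\<^sub>R (1::'f)"
    by (rule iffD1[OF norm_cauchy_schwarz_eq])
  then show ?thesis by (simp add: of_real_def)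
qed simp

definition perm_mat :: "('n \<Rightarrow> 'n) \<Rightarrow> 'f::rch_algebra^'n^'n"
  where "perm_mat \<pi> = (\<chi> r s. if s = \<pi> r then 1 else 0)"

lemma perm_mat_mult_nth: "(perm_mat \<pi> ** A) $ r $ s = (A::'f::rch_algebra^'n^'n) $ \<pi> r $ s"
  by (simp add: perm_mat_def matrix_matrix_mult_def if_distrib if_distribR cong: if_cong)

text \<open>Involutions include the transpositions, which compare two diagonal entries; their permutation
  matrices are Hermitian.\<close>

lemma perm_mat_involution:
  assumes "\<And>k. \<pi> (\<pi> k) = k"
  shows "(perm_mat \<pi> :: 'f::rch_algebra^'n^'n) \<in> unitary_group"
    and "perm_mat \<pi> ** diag_mat d ** ctranspose (perm_mat \<pi>) = (diag_mat (\<chi> k. d $ \<pi> k) :: 'f::rch_algebra^'n^'n)"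
proof -
  have [simp]: "ctranspose (perm_mat \<pi>) = (perm_mat \<pi> :: 'f::rch_algebra^'n^'n)"
    using assms by (auto simp: ctranspose_def perm_mat_def vec_eq_iff)
  have "perm_mat \<pi> ** perm_mat \<pi> = (mat 1 :: 'f::rch_algebra^'n^'n)"
    using assms by (simp add: vec_eq_iff perm_mat_mult_nth) (auto simp: perm_mat_def mat_def)
  then show "(perm_mat \<pi> :: 'f::rch_algebra^'n^'n) \<in> unitary_group"
    by (simp add: unitary_group_def)
  show "perm_mat \<pi> ** diag_mat d ** ctranspose (perm_mat \<pi>) = (diag_mat (\<chi> k. d $ \<pi> k) :: 'f::rch_algebra^'n^'n)"
    using assms
    by (simp add: vec_eq_iff matrix_mul_assoc[symmetric] perm_mat_mult_nth diag_mat_mult_nth)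
       (auto simp: perm_mat_def diag_mat_nth of_real_def)
qed

definition closed_weyl_chamber :: "(real^'n::{finite,linorder}) set"
  where "closed_weyl_chamber = {\<sigma>. (\<forall>i j. i < j \<longrightarrow> \<sigma> $ i \<ge> \<sigma> $ j) \<and> (\<forall>i. 0 \<le> \<sigma> $ i)}"

text \<open>The number of indices from \<open>i\<close> on: some point of the open Weyl chamber, available for every finite
  linear order.\<close>

definition index_weights :: "real^'n::{finite,linorder}"
  where "index_weights = (\<chi> i. real (card {i..}))"

lemma index_weights_weyl: "(index_weights :: real^'n::{finite,linorder}) \<in> weyl_chamber"
proof -
  have "card {j..} < card {i..}" if "i < j" for i j :: 'n
    using that by (intro psubset_card_mono) auto
  moreover have "0 < card {i..}" for i :: 'n
    using card_gt_0_iff by fastforce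
  ultimately show ?thesis by (simp add: weyl_chamber_def index_weights_def)
qed

text \<open>A point of the orbit of \<open>D\<close> that is closest to \<open>M\<close> exists because the orbit is compact; all points of
  the orbit have the same norm, so closest means largest inner product.\<close>

lemma unitary_alignment:
  fixes D M :: "'f::rch_algebra^'n^'n"
  obtains U V where "U \<in> unitary_group" "V \<in> unitary_group"
    "\<And>U' V'. U' \<in> unitary_group \<Longrightarrow> V' \<in> unitary_group \<Longrightarrow>
       inner (U' ** D ** ctranspose V') M \<le> inner (U ** D ** ctranspose V) M"
proof -
  let ?K = "(unitary_group :: ('f^'n^'n) set) \<times> (unitary_group :: ('f^'n^'n) set)"
  have K: "compact ?K"
    by (intro compact_Times compact_unitary_group)
  have "continuous_on ?K (\<lambda>p. inner (fst p ** D ** ctranspose (snd p)) M)"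
    by (intro continuous_intros matmul.continuous_on bounded_linear.continuous_on[OF bounded_linear_ctranspose])
  moreover have "?K \<noteq> {}" using unitary_one by blast
  ultimately obtain p where "p \<in> ?K"
    "\<forall>q\<in>?K. inner (fst q ** D ** ctranspose (snd q)) M \<le> inner (fst p ** D ** ctranspose (snd p)) M"
    using continuous_attains_sup[OF K] by blast
  then show thesis using that[of "fst p" "snd p"] by force
qed

text \<open>If \<open>U D V\<^sup>*\<close> is the point closest to \<open>M\<close> in the orbit of a diagonal matrix \<open>D\<close> with strictly
  decreasing positive entries \<open>d\<close>, then the identity maximizes the inner product with \<open>D N\<close> and with
  \<open>N D\<close> for \<open>N = U\<^sup>* M V\<close>. So both are Hermitian, whence \<open>D\<^sup>2 N = N D\<^sup>2\<close>, and \<open>N\<close> is diagonal because the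
  squares of the \<open>d\<close> are distinct. The rearrangement inequality then sorts the diagonal.\<close>

theorem singular_value_decomposition:
  fixes M :: "('f::rch_algebra, 'n::{finite,linorder}) sqmat"
  obtains U V \<sigma> where "U \<in> unitary_group" "V \<in> unitary_group" "\<sigma> \<in> closed_weyl_chamber"
    "M = U ** diag_mat \<sigma> ** ctranspose V"
proof -
  \<comment> \<open>Any strictly decreasing positive weights serve.\<close>
  define d :: "real^'n::{finite,linorder}" where "d = index_weights"
  have d_dec: "i < j \<Longrightarrow> d $ j < d $ i" and d_pos: "0 < d $ i" for i j :: 'n
    using index_weights_weyl by (auto simp: d_def weyl_chamber_def)
  define D :: "('f, 'n) sqmat" where "D = diag_mat d"
  obtain U V where U: "U \<in> unitary_group" and V: "V \<in> unitary_group"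
    and max: "\<And>U' V'. U' \<in> unitary_group \<Longrightarrow> V' \<in> unitary_group \<Longrightarrow>
       inner (U' ** D ** ctranspose V') M \<le> inner (U ** D ** ctranspose V) M"
    using unitary_alignment[of D M] by blast
  define N where "N = ctranspose U ** M ** V"
  have M: "M = U ** N ** ctranspose V"
    using U V by (simp add: N_def matrix_mul_assoc[symmetric] unitary_cancel unitary_groupD)
  have maxN: "inner (W ** D ** ctranspose W') N \<le> inner D N"
    if "W \<in> unitary_group" "W' \<in> unitary_group" for W W'
  proof -
    have eq: "inner (U ** W ** D ** ctranspose (V ** W')) M = inner (W ** D ** ctranspose W') N" for W W'
      using inner_sandwich[of U "W ** D ** ctranspose W'" V M]
      by (simp add: N_def ctranspose_mult matrix_mul_assoc)
    from max[OF unitary_mult[OF U that(1)] unitary_mult[OF V that(2)]]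
    show ?thesis using eq[of W W'] eq[of "mat 1" "mat 1"] by simp
  qed
  have maxDN: "inner W (ctranspose D ** N) \<le> inner (mat 1) (ctranspose D ** N)"
      if "W \<in> unitary_group" for W
    using maxN[OF unitary_one unitary_ctranspose[OF that]] 
      inner_matrix_mult_left[of D W N] inner_matrix_mult_left[of D "mat 1" N] by simp
  have maxND: "inner W (N ** ctranspose D) \<le> inner (mat 1) (N ** ctranspose D)"
      if "W \<in> unitary_group" for W
    using maxN[OF that unitary_one] 
      inner_matrix_mult_right[of W D N] inner_matrix_mult_right[of "mat 1" D N] by simp
  have off: "N $ i $ j = 0" if ij: "i \<noteq> j" for i j
  proof -
    define c where "c = conjg (N $ j $ i)"
    have e1: "d $ i *\<^sub>R N $ i $ j = d $ j *\<^sub>R c"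
      using entry_if_identity_maximizes[OF maxDN ij]
      by (simp add: D_def c_def diag_mat_mult_nth linear_scale[OF linear_conjg])
    have e2: "d $ j *\<^sub>R N $ i $ j = d $ i *\<^sub>R c"
      using entry_if_identity_maximizes[OF maxND ij]
      by (simp add: D_def c_def mult_diag_mat_nth linear_scale[OF linear_conjg])
    have "(d $ i * d $ i) *\<^sub>R N $ i $ j = d $ i *\<^sub>R (d $ j *\<^sub>R c)"
      unfolding e1[symmetric] by simp
    also have "\<dots> = d $ j *\<^sub>R (d $ i *\<^sub>R c)" by (simp add: mult.commute)
    also have "\<dots> = (d $ j * d $ j) *\<^sub>R N $ i $ j"
      unfolding e2[symmetric] by simp
    finally have "(d $ i * d $ i) *\<^sub>R N $ i $ j = (d $ j * d $ j) *\<^sub>R N $ i $ j" .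
    moreover have "d $ i \<noteq> d $ j"
      using d_dec[of i j] d_dec[of j i] ij by (cases i j rule: linorder_cases) auto
    then have "d $ i * d $ i \<noteq> d $ j * d $ j"
      using d_pos[of i] d_pos[of j] by (simp add: square_eq_iff)
    ultimately show ?thesis by simp
  qed
  define \<sigma> where "\<sigma> = (\<chi> i. norm (N $ i $ i))"
  have "N $ i $ i = of_real (norm (N $ i $ i))" for i
  proof -
    have "d $ i *\<^sub>R N $ i $ i = d $ i *\<^sub>R of_real (norm (N $ i $ i))"
      using diag_entry_if_identity_maximizes[OF maxDN, of i] d_pos[of i]
      by (simp add: D_def diag_mat_mult_nth of_real_def)
    then show ?thesis using d_pos[of i] by simp
  qed
  then have N: "N = diag_mat \<sigma>"
    using off by (auto simp: vec_eq_iff diag_mat_nth \<sigma>_def)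
  have "\<sigma> $ j \<le> \<sigma> $ i" if "i < j" for i j
  proof -
    \<comment> \<open>Exchanging the two weights must not increase the inner product.\<close>
    define \<pi> where "\<pi> = Transposition.transpose i j"
    have \<pi>: "\<pi> (\<pi> k) = k" for k by (simp add: \<pi>_def)
    have "inner (\<chi> k. d $ \<pi> k) \<sigma> \<le> inner d \<sigma>"
      using maxN[OF perm_mat_involution(1)[OF \<pi>] perm_mat_involution(1)[OF \<pi>]]
      unfolding D_def perm_mat_involution(2)[OF \<pi>] N by (simp add: inner_diag_mat)
    then have "0 \<le> (\<Sum>k\<in>UNIV. (d $ k - d $ \<pi> k) * \<sigma> $ k)"
      by (simp add: inner_vec_def left_diff_distrib sum_subtractf)
    also have "\<dots> = (\<Sum>k\<in>{i, j}. (d $ k - d $ \<pi> k) * \<sigma> $ k)"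
      by (rule sum.mono_neutral_right) (auto simp: \<pi>_def Transposition.transpose_def)
    also have "\<dots> = (d $ i - d $ j) * (\<sigma> $ i - \<sigma> $ j)"
      using that by (simp add: \<pi>_def algebra_simps)
    finally show ?thesis using d_dec[OF that] by (simp add: zero_le_mult_iff)
  qed
  then have "\<sigma> \<in> closed_weyl_chamber"
    by (simp add: closed_weyl_chamber_def \<sigma>_def)
  with that U V M N show thesis by blast
qed

section \<open>Singular values and the Weyl chamber as a chart\<close>

text \<open>Order and sign of \<open>\<sigma>\<close> are left open here; they are imposed by membership in the open or the closed
  Weyl chamber.\<close>

definition is_svd :: "'f::rch_algebra^'n^'n \<Rightarrow> 'f^'n^'n \<Rightarrow> real^'n \<Rightarrow> 'f^'n^'n \<Rightarrow> bool"
  where "is_svd U V \<sigma> M \<longleftrightarrow>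
    U \<in> unitary_group \<and> V \<in> unitary_group \<and> M = U ** diag_mat \<sigma> ** ctranspose V"

lemma is_svd_gram:
  assumes "is_svd U V \<sigma> M"
  shows "ctranspose M ** M = V ** diag_mat (\<chi> i. \<sigma> $ i * \<sigma> $ i) ** ctranspose V"
proof -
  have U: "U \<in> unitary_group" and M: "M = U ** diag_mat \<sigma> ** ctranspose V"
    using assms by (simp_all add: is_svd_def)
  show ?thesis
    unfolding M diag_mat_mult[symmetric]
    by (simp add: ctranspose_mult matrix_mul_assoc[symmetric] unitary_cancel[OF U])
qed

lemma dim_coordinate_subspace:
  "dim {w :: 'a::euclidean_space^'n. \<forall>i. i \<notin> I \<longrightarrow> w $ i = 0} = DIM('a) * card I"
proof -
  let ?d = "(\<lambda>(i, b). axis i b) ` (I \<times> (Basis :: 'a set))"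
  have d: "axis i b \<in> ?d \<longleftrightarrow> i \<in> I" if "b \<in> Basis" for i and b :: 'a
    using that by (auto simp: axis_eq_axis image_iff dest: nonzero_Basis)
  have "?d \<subseteq> (Basis :: ('a^'n) set)"
    by (auto simp: Basis_vec_def)
  then have "dim {w :: 'a^'n. \<forall>b\<in>Basis. b \<notin> ?d \<longrightarrow> w \<bullet> b = 0} = card ?d"
    by (rule dim_substandard)
  also have "{w :: 'a^'n. \<forall>b\<in>Basis. b \<notin> ?d \<longrightarrow> w \<bullet> b = 0} = {w. \<forall>i. i \<notin> I \<longrightarrow> w $ i = 0}"
    by (auto simp: Basis_vec_def d inner_axis euclidean_eq_iff[where 'a='a])
  also have "card ?d = card (I \<times> (Basis :: 'a set))"
    by (rule card_image) (auto simp: inj_on_def axis_eq_axis dest: nonzero_Basis)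
  finally show ?thesis by (simp add: card_cartesian_product mult.commute)
qed

text \<open>The eigenspace of \<open>M\<^sup>* M = V \<Sigma>\<^sup>2 V\<^sup>*\<close> for \<open>s\<^sup>2\<close> is the image under \<open>V\<close> of the coordinate subspace of the
  indices with \<open>\<sigma>\<^sub>i = s\<close>. Nonnegativity is what lets \<open>\<sigma>\<^sub>i\<^sup>2 = s\<^sup>2\<close> determine \<open>\<sigma>\<^sub>i = s\<close>.\<close>

lemma singular_values_of_svd:
  fixes M :: "'f::rch_algebra^'n^'n"
  assumes svd: "is_svd U V \<sigma> M" and nonneg: "\<And>i. 0 \<le> \<sigma> $ i"
  shows "singular_values M \<sigma>"
proof -
  have V: "V \<in> unitary_group" using svd by (simp add: is_svd_def)
  have "dim {v. (ctranspose M ** M) *v v = s\<^sup>2 *\<^sub>R v} = DIM('f) * card {i. \<sigma> $ i = s}"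
    if s: "0 \<le> s" for s
  proof -
    let ?E = "{w :: 'f^'n. \<forall>i. i \<notin> {i. \<sigma> $ i = s} \<longrightarrow> w $ i = 0}"
    have sq: "\<sigma> $ i * \<sigma> $ i = s\<^sup>2 \<longleftrightarrow> \<sigma> $ i = s" for i
      using nonneg[of i] s by (metis power2_eq_square power2_eq_imp_eq)
    have E: "diag_mat (\<chi> i. \<sigma> $ i * \<sigma> $ i) *v w = s\<^sup>2 *\<^sub>R w \<longleftrightarrow> w \<in> ?E" for w :: "'f^'n"
      by (auto simp: vec_eq_iff diag_mat_mult_vec_nth sq)
    have VV: "V *v (ctranspose V *v v) = v" "ctranspose V *v (V *v v) = v" for v
      by (simp_all add: matrix_vector_mul_assoc unitary_groupD[OF V])
    have scale: "A *v (r *\<^sub>R v) = r *\<^sub>R (A *v v)" for A :: "'f^'n^'n" and r v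
      by (rule linear_scale[OF matrix_vector_mul_linear])
    have eig: "(ctranspose M ** M) *v v = s\<^sup>2 *\<^sub>R v \<longleftrightarrow> ctranspose V *v v \<in> ?E" for v
    proof -
      have "(ctranspose M ** M) *v v = V *v (diag_mat (\<chi> i. \<sigma> $ i * \<sigma> $ i) *v (ctranspose V *v v))"
        by (simp add: is_svd_gram[OF svd] matrix_vector_mul_assoc matrix_mul_assoc)
      then show ?thesis unfolding E[symmetric] by (metis VV scale)
    qed
    have "{v. (ctranspose M ** M) *v v = s\<^sup>2 *\<^sub>R v} = (*v) V ` ?E"
    proof (intro set_eqI iffI)
      fix v assume "v \<in> {v. (ctranspose M ** M) *v v = s\<^sup>2 *\<^sub>R v}"
      then have "ctranspose V *v v \<in> ?E" unfolding mem_Collect_eq[of v] eig .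
      then have "V *v (ctranspose V *v v) \<in> (*v) V ` ?E" by (rule imageI)
      then show "v \<in> (*v) V ` ?E" unfolding VV .
    next
      fix v assume "v \<in> (*v) V ` ?E"
      then obtain w where "v = V *v w" "w \<in> ?E" by (rule imageE)
      then have "ctranspose V *v v \<in> ?E" by (simp only: VV)
      then show "v \<in> {v. (ctranspose M ** M) *v v = s\<^sup>2 *\<^sub>R v}" unfolding mem_Collect_eq[of v] eig .
    qed
    also have "dim \<dots> = dim ?E"
    proof (rule dim_image_eq)
      show "inj_on ((*v) V) (span ?E)"
        by (rule inj_on_inverseI[of _ "(*v) (ctranspose V)"]) (simp add: VV)
    qed simp
    also have "\<dots> = DIM('f) * card {i. \<sigma> $ i = s}"
      by (rule dim_coordinate_subspace)
    finally show ?thesis .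
  qed
  then show ?thesis using nonneg by (simp add: singular_values_def)
qed

lemma singular_values_count:
  fixes M :: "'f::rch_algebra^'n^'n"
  assumes "singular_values M \<sigma>" "singular_values M \<tau>" "0 \<le> s"
  shows "card {i. \<sigma> $ i = s} = card {i. \<tau> $ i = s}"
proof -
  have "DIM('f) * card {i. \<sigma> $ i = s} = DIM('f) * card {i. \<tau> $ i = s}"
    using assms by (simp add: singular_values_def)
  then show ?thesis using DIM_positive[where 'a='f] by simp
qed

lemma singular_values_inj:
  fixes M :: "'f::rch_algebra^'n^'n"
  assumes "singular_values M \<sigma>" "singular_values M \<tau>" "inj (($) \<tau>)"
  shows "inj (($) \<sigma>)"
proof (rule injI, rule ccontr)
  fix i j assume ij: "\<sigma> $ i = \<sigma> $ j" "i \<noteq> j"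
  have "0 \<le> \<sigma> $ i" using assms(1) by (simp add: singular_values_def)
  have "card {i, j} \<le> card {k. \<sigma> $ k = \<sigma> $ i}"
    using ij by (intro card_mono) auto
  also have "\<dots> = card {k. \<tau> $ k = \<sigma> $ i}"
    using singular_values_count[OF assms(1,2) \<open>0 \<le> \<sigma> $ i\<close>] .
  also have "\<dots> \<le> 1"
    using assms(3) by (auto simp: card_le_Suc0_iff_eq inj_def)
  finally show False using ij by simp
qed

lemma singular_values_range:
  fixes M :: "'f::rch_algebra^'n^'n"
  assumes "singular_values M \<sigma>" "singular_values M \<tau>"
  shows "range (($) \<sigma>) = range (($) \<tau>)"
proof -
  have "range (($) \<sigma>) \<subseteq> range (($) \<tau>)" if "singular_values M \<sigma>" "singular_values M \<tau>" for \<sigma> \<tau>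
  proof clarify
    fix i
    have "0 \<le> \<sigma> $ i" using that by (simp add: singular_values_def)
    have "card {k. \<sigma> $ k = \<sigma> $ i} \<noteq> 0" by (auto simp: card_eq_0_iff)
    then have "card {k. \<tau> $ k = \<sigma> $ i} \<noteq> 0"
      using singular_values_count[OF that \<open>0 \<le> \<sigma> $ i\<close>] by simp
    then have "{k. \<tau> $ k = \<sigma> $ i} \<noteq> {}" by (metis card.empty)
    then show "\<sigma> $ i \<in> range (($) \<tau>)" by (metis (mono_tags) Collect_empty_eq rangeI)
  qed
  then show ?thesis using assms by blast
qed

text \<open>The position of a value in a strictly decreasing family can be read off from the range alone, as
  the number of greater values.\<close>

lemma strictly_decreasing_eq_if_range_eq:
  fixes f g :: "'n::{finite,linorder} \<Rightarrow> 'b::linorder"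
  assumes f: "\<And>i j. i < j \<Longrightarrow> f j < f i" and g: "\<And>i j. i < j \<Longrightarrow> g j < g i"
    and "range f = range g"
  shows "f = g"
proof
  fix i
  have iff: "h i < h k \<longleftrightarrow> k < i" if "\<And>i j. i < j \<Longrightarrow> h j < h i" for h :: "'n \<Rightarrow> 'b" and i k
    using that by (metis linorder_neqE order_less_asym order_less_irrefl)
  have card: "card {y \<in> range h. h i < y} = card {..<i}"
    if h: "\<And>i j. i < j \<Longrightarrow> h j < h i" for h :: "'n \<Rightarrow> 'b" and i
  proof -
    have "inj h" using h by (metis injI linorder_neqE order_less_irrefl)
    moreover have "{y \<in> range h. h i < y} = h ` {..<i}" using iff[of h, OF h] by auto
    ultimately show ?thesis by (simp add: card_image inj_on_subset)
  qed
  obtain j where j: "f i = g j" using assms(3) by (metis rangeE rangeI)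
  then have "card {..<i} = card {..<j}"
    using card[of f i, OF f] card[of g j, OF g] assms(3) by simp
  moreover have "card {..<a} < card {..<b}" if "a < b" for a b :: 'n
    using that by (intro psubset_card_mono) auto
  ultimately have "i = j" by (metis linorder_neqE order_less_irrefl)
  then show "f i = g i" using j by simp
qed

lemma weyl_chamber_subset_closed: "weyl_chamber \<subseteq> closed_weyl_chamber"
  by (auto simp: weyl_chamber_def closed_weyl_chamber_def less_imp_le)

lemma inj_weyl_chamber: "\<sigma> \<in> weyl_chamber \<Longrightarrow> inj (($) \<sigma>)"
  by (rule injI) (metis (mono_tags, lifting) linorder_neqE mem_Collect_eq order_less_irrefl weyl_chamber_def)

text \<open>Multiplicities are determined by \<open>M\<close>. As those of \<open>\<sigma>\<close> are at most one, so are those of \<open>\<tau>\<close>, hence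
  \<open>\<tau>\<close> decreases strictly and is determined by its range.\<close>

lemma singular_values_unique:
  fixes M :: "('f::rch_algebra, 'n::{finite,linorder}) sqmat"
  assumes "singular_values M \<sigma>" "singular_values M \<tau>"
    "\<sigma> \<in> weyl_chamber" "\<tau> \<in> closed_weyl_chamber"
  shows "\<tau> = \<sigma>"
proof -
  have "inj (($) \<tau>)"
    using singular_values_inj assms inj_weyl_chamber by blast
  then have "\<tau> $ j < \<tau> $ i" if "i < j" for i j
    using assms(4) that unfolding closed_weyl_chamber_def
    by (metis (mono_tags, lifting) injD mem_Collect_eq order_le_imp_less_or_eq order_less_irrefl)
  moreover have "\<sigma> $ j < \<sigma> $ i" if "i < j" for i j
    using assms(3) that by (simp add: weyl_chamber_def)
  ultimately have "($) \<tau> = ($) \<sigma>"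
    using singular_values_range[OF assms(2,1)] by (intro strictly_decreasing_eq_if_range_eq)
  then show ?thesis by (simp add: vec_eq_iff)
qed

lemma closed_weyl_chamber_nonneg: "\<sigma> \<in> closed_weyl_chamber \<Longrightarrow> 0 \<le> \<sigma> $ i"
  by (simp add: closed_weyl_chamber_def)

lemma is_svd_unique:
  fixes M :: "('f::rch_algebra, 'n::{finite,linorder}) sqmat"
  assumes "is_svd U V \<sigma> M" "is_svd U' V' \<tau> M" "\<sigma> \<in> weyl_chamber" "\<tau> \<in> closed_weyl_chamber"
  shows "\<tau> = \<sigma>"
  using assms weyl_chamber_subset_closed closed_weyl_chamber_nonneg
  by (intro singular_values_unique[of M]) (blast intro: singular_values_of_svd)+

lemma is_svd_invertible:
  assumes "is_svd U V \<sigma> M" "\<And>i. \<sigma> $ i \<noteq> 0"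
  shows "invertible M"
proof -
  have U: "U \<in> unitary_group" and V: "V \<in> unitary_group" and M: "M = U ** diag_mat \<sigma> ** ctranspose V"
    using assms by (simp_all add: is_svd_def)
  let ?D = "diag_mat (\<chi> i. inverse (\<sigma> $ i))"
  have "diag_mat \<sigma> ** ?D = (mat 1 :: 'a^'b^'b)"
    using assms(2) by (simp add: diag_mat_mult flip: diag_mat_one)
  then have "diag_mat \<sigma> ** (?D ** A) = (A :: 'a^'b^'b)" for A
    by (simp add: matrix_mul_assoc)
  then have "M ** (V ** ?D ** ctranspose U) = mat 1"
    by (simp add: M matrix_mul_assoc[symmetric] unitary_cancel[OF V] unitary_groupD[OF U])
  then show ?thesis
    using matrix_left_inverse_if_right_inverse unfolding invertible_def by blast
qed

text \<open>For the forward direction, the existence of distinct singular values in any order is transferred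
  to the sorted decomposition, and a vanishing singular value would give a kernel vector.\<close>

lemma regular_GL_iff:
  fixes M :: "('f::rch_algebra, 'n::{finite,linorder}) sqmat"
  shows "M \<in> regular_GL \<longleftrightarrow> (\<exists>U V. \<exists>\<sigma>\<in>weyl_chamber. is_svd U V \<sigma> M)"
proof
  assume "M \<in> regular_GL"
  then obtain \<tau> where inv: "invertible M" and \<tau>: "singular_values M \<tau>" "inj (($) \<tau>)"
    by (auto simp: regular_GL_def)
  obtain U V \<sigma> where svd: "is_svd U V \<sigma> M" and \<sigma>: "\<sigma> \<in> closed_weyl_chamber"
    using singular_value_decomposition[of M] unfolding is_svd_def by metis
  have inj: "inj (($) \<sigma>)"
    using singular_values_inj singular_values_of_svd[OF svd closed_weyl_chamber_nonneg[OF \<sigma>]] \<tau> by blast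
  have "\<sigma> $ i \<noteq> 0" for i
  proof
    assume "\<sigma> $ i = 0"
    then have D0: "diag_mat \<sigma> *v axis i 1 = (0 :: 'f^'n::{finite,linorder})"
      by (simp add: vec_eq_iff diag_mat_mult_vec_nth axis_def)
    obtain N where "N ** M = mat 1" using inv by (auto simp: invertible_def)
    moreover have "M ** V = U ** diag_mat \<sigma>"
      using svd by (auto simp: is_svd_def matrix_mul_assoc[symmetric] unitary_groupD)
    ultimately have "V = N ** (U ** diag_mat \<sigma>)"
      by (metis matrix_mul_assoc matrix_mul_lid)
    then have "V *v axis i 1 = 0"
      by (simp add: D0 flip: matrix_vector_mul_assoc)
    then have "(ctranspose V ** V) *v axis i 1 = 0"
      by (simp flip: matrix_vector_mul_assoc)
    then show False
      using svd by (simp add: is_svd_def unitary_groupD)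
  qed
  then have "\<sigma> \<in> weyl_chamber"
    using \<sigma> inj unfolding weyl_chamber_def closed_weyl_chamber_def inj_def
    by (auto simp: less_le)
  then show "\<exists>U V. \<exists>\<sigma>\<in>weyl_chamber. is_svd U V \<sigma> M" using svd by blast
next
  assume "\<exists>U V. \<exists>\<sigma>\<in>weyl_chamber. is_svd U V \<sigma> M"
  then obtain U V \<sigma> where svd: "is_svd U V \<sigma> M" and \<sigma>: "\<sigma> \<in> weyl_chamber" by blast
  have pos: "0 < \<sigma> $ i" for i using \<sigma> by (simp add: weyl_chamber_def)
  have "invertible M"
    by (rule is_svd_invertible[OF svd]) (use pos in \<open>simp add: less_imp_neq[symmetric]\<close>)
  moreover have "singular_values M \<sigma>"
    by (rule singular_values_of_svd[OF svd]) (use pos in \<open>simp add: less_imp_le\<close>)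
  ultimately show "M \<in> regular_GL"
    using inj_weyl_chamber[OF \<sigma>] by (auto simp: regular_GL_def)
qed

lemma unitary_orbit_eq:
  fixes A :: "'f::rch_algebra^'n^'n"
  assumes U: "U \<in> unitary_group" and V: "V \<in> unitary_group"
  shows "unitary_orbit (U ** A ** ctranspose V) = unitary_orbit A"
proof -
  have sub: "unitary_orbit (U ** A ** ctranspose V) \<subseteq> unitary_orbit A"
    if "U \<in> unitary_group" "V \<in> unitary_group" for U V A :: "'f^'n^'n"
  proof
    fix X assume "X \<in> unitary_orbit (U ** A ** ctranspose V)"
    then obtain P Q where "P \<in> unitary_group" "Q \<in> unitary_group"
        "X = P ** (U ** A ** ctranspose V) ** ctranspose Q"
      by (auto simp: unitary_orbit_def)
    then have "X = (P ** U) ** A ** ctranspose (Q ** V)"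
      "P ** U \<in> unitary_group" "Q ** V \<in> unitary_group"
      using that by (simp_all add: ctranspose_mult matrix_mul_assoc unitary_mult)
    then show "X \<in> unitary_orbit A" unfolding unitary_orbit_def by blast
  qed
  have "ctranspose U ** (U ** A ** ctranspose V) ** ctranspose (ctranspose V) = A"
    by (simp add: matrix_mul_assoc[symmetric] unitary_cancel[OF U] unitary_groupD[OF V])
  then show ?thesis
    using sub[OF U V, of A] sub[OF unitary_ctranspose[OF U] unitary_ctranspose[OF V], of "U ** A ** ctranspose V"]
    by simp
qed

lemma is_svd_orbit: "is_svd U V \<sigma> M \<Longrightarrow> unitary_orbit M = weyl_chart \<sigma>"
  by (auto simp: is_svd_def weyl_chart_def unitary_orbit_eq)

lemma weyl_chartE:
  assumes "M \<in> weyl_chart \<sigma>"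
  obtains U V where "is_svd U V \<sigma> M"
  using assms by (auto simp: weyl_chart_def unitary_orbit_def is_svd_def)

lemma is_svd_diag: "is_svd (mat 1) (mat 1) \<sigma> (diag_mat \<sigma>)"
  by (simp add: is_svd_def unitary_one)

lemma diag_mat_regular:
  "\<sigma> \<in> weyl_chamber \<Longrightarrow> (diag_mat \<sigma> :: ('f::rch_algebra, 'n::{finite,linorder}) sqmat) \<in> regular_GL"
  using regular_GL_iff is_svd_diag by blast

lemma inj_on_weyl_chart:
  "inj_on (weyl_chart :: _ \<Rightarrow> (('f::rch_algebra, 'n::{finite,linorder}) sqmat) set) weyl_chamber"
proof (rule inj_onI)
  fix \<sigma> \<tau> :: "real^'n::{finite,linorder}"
  assume *: "\<sigma> \<in> weyl_chamber" "\<tau> \<in> weyl_chamber"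
    and eq: "(weyl_chart \<sigma> :: (('f, 'n::{finite,linorder}) sqmat) set) = weyl_chart \<tau>"
  have "(diag_mat \<sigma> :: ('f, 'n::{finite,linorder}) sqmat) \<in> weyl_chart \<sigma>"
    using unitary_one is_svd_diag[of \<sigma>]
    unfolding weyl_chart_def unitary_orbit_def is_svd_def by blast
  then obtain U V :: "('f, 'n::{finite,linorder}) sqmat" where "is_svd U V \<tau> (diag_mat \<sigma>)"
    using eq weyl_chartE by metis
  then show "\<sigma> = \<tau>"
    using is_svd_unique[OF _ is_svd_diag] * weyl_chamber_subset_closed by blast
qed

lemma quotient_map_of_svd:
  fixes M :: "('f::rch_algebra, 'n::{finite,linorder}) sqmat"
  assumes "is_svd U V \<sigma> M" "\<sigma> \<in> weyl_chamber"
  shows "quotient_map_in_chart M = \<sigma>"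
  unfolding quotient_map_in_chart_def is_svd_orbit[OF assms(1)]
  by (rule the_inv_into_f_f[OF inj_on_weyl_chart assms(2)])

lemma quotient_map_svd:
  fixes M :: "('f::rch_algebra, 'n::{finite,linorder}) sqmat"
  assumes "M \<in> regular_GL"
  shows "quotient_map_in_chart M \<in> weyl_chamber"
    and "\<exists>U V. is_svd U V (quotient_map_in_chart M) M"
    and "unitary_orbit M = weyl_chart (quotient_map_in_chart M)"
  using assms quotient_map_of_svd is_svd_orbit unfolding regular_GL_iff by metis+

lemma quotient_map_diag_mat:
  "\<sigma> \<in> weyl_chamber \<Longrightarrow>
    quotient_map_in_chart (diag_mat \<sigma> :: ('f::rch_algebra, 'n::{finite,linorder}) sqmat) = \<sigma>"
  by (rule quotient_map_of_svd[OF is_svd_diag])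

lemma open_weyl_chamber: "open (weyl_chamber :: (real^'n::{finite,linorder}) set)"
proof -
  have "weyl_chamber = (\<Inter>i. \<Inter>j\<in>{i<..}. {\<sigma>. \<sigma> $ j < \<sigma> $ i}) \<inter> (\<Inter>i. {\<sigma> :: real^'n::{finite,linorder}. 0 < \<sigma> $ i})"
    by (auto simp: weyl_chamber_def)
  also have "open \<dots>"
    by (intro open_Int open_INT ballI open_Collect_less continuous_intros) auto
  finally show ?thesis .
qed

lemma closed_closed_weyl_chamber: "closed (closed_weyl_chamber :: (real^'n::{finite,linorder}) set)"
proof -
  have "closed_weyl_chamber = (\<Inter>i. \<Inter>j\<in>{i<..}. {\<sigma>. \<sigma> $ j \<le> \<sigma> $ i}) \<inter> (\<Inter>i. {\<sigma> :: real^'n::{finite,linorder}. 0 \<le> \<sigma> $ i})"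
    by (auto simp: closed_weyl_chamber_def)
  also have "closed \<dots>"
    by (intro closed_Int closed_INT ballI closed_Collect_le continuous_intros)
  finally show ?thesis .
qed

text \<open>The map \<open>(U, V, \<sigma>) \<mapsto> U \<Sigma> V\<^sup>*\<close> is closed, although its last argument is not confined to a compact
  set: the condition is that \<open>U\<^sup>* M V\<close> lies in the closed set of diagonal matrices over \<open>C\<close>, and the
  projection along the compact factor of the pairs \<open>(U, V)\<close> preserves closedness.\<close>

lemma closed_svd_image:
  fixes C :: "(real^'n) set"
  assumes "closed C"
  shows "closed {M :: 'f::rch_algebra^'n^'n. \<exists>U V. \<exists>\<sigma>\<in>C. is_svd U V \<sigma> M}"
proof -
  let ?K = "(unitary_group :: ('f^'n^'n) set) \<times> (unitary_group :: ('f^'n^'n) set)"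
  let ?f = "\<lambda>q :: (('f^'n^'n) \<times> ('f^'n^'n)) \<times> ('f^'n^'n). ctranspose (fst (fst q)) ** snd q ** snd (fst q)"
  have "inj (diag_mat :: real^'n \<Rightarrow> 'f^'n^'n)"
  proof (rule injI)
    fix \<sigma> \<tau> assume eq: "diag_mat \<sigma> = (diag_mat \<tau> :: 'f^'n^'n)"
    have "\<sigma> $ i = \<tau> $ i" for i
      using arg_cong[OF eq, of "\<lambda>A. A $ i $ i"] by (simp add: diag_mat_nth)
    then show "\<sigma> = \<tau>" by (simp add: vec_eq_iff)
  qed
  then have "closed (diag_mat ` C :: ('f^'n^'n) set)"
    using closed_injective_linear_image[OF assms linear_diag_mat] by blast
  moreover have "continuous_on UNIV ?f"
    by (intro matmul.continuous_on bounded_linear.continuous_on[OF bounded_linear_ctranspose]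
      continuous_on_fst continuous_on_snd continuous_on_id)
  ultimately have "closed (?f -` (diag_mat ` C))"
    by (rule closed_vimage)
  with compact_Times[OF compact_unitary_group compact_unitary_group]
  have "closed {M. \<exists>p. p \<in> ?K \<and> (p, M) \<in> ?f -` (diag_mat ` C)}"
    by (rule closed_compact_projection)
  also have "{M. \<exists>p. p \<in> ?K \<and> (p, M) \<in> ?f -` (diag_mat ` C)} = {M. \<exists>U V. \<exists>\<sigma>\<in>C. is_svd U V \<sigma> M}"
  proof -
    have "ctranspose U ** M ** V = D \<longleftrightarrow> M = U ** D ** ctranspose V"
      if U: "U \<in> unitary_group" and V: "V \<in> unitary_group" for U V M D :: "'f^'n^'n"
    proof
      assume "ctranspose U ** M ** V = D"
      then show "M = U ** D ** ctranspose V"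
        by (auto simp: matrix_mul_assoc[symmetric] unitary_cancel[OF U] unitary_groupD[OF V])
    next
      assume "M = U ** D ** ctranspose V"
      then show "ctranspose U ** M ** V = D"
        by (auto simp: matrix_mul_assoc[symmetric] unitary_cancel[OF U] unitary_groupD[OF V])
    qed
    then show ?thesis by (auto simp: is_svd_def image_iff) blast+
  qed
  finally show ?thesis .
qed

text \<open>The complement consists of the matrices with a decomposition on the boundary of the chamber.\<close>

lemma open_regular_GL:
  "open (regular_GL :: (('f::rch_algebra, 'n::{finite,linorder}) sqmat) set)"
proof -
  have "- regular_GL = {M :: ('f, 'n::{finite,linorder}) sqmat. \<exists>U V. \<exists>\<sigma>\<in>closed_weyl_chamber - weyl_chamber. is_svd U V \<sigma> M}"
  proof (intro set_eqI iffI)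
    fix M :: "('f, 'n::{finite,linorder}) sqmat"
    assume M: "M \<in> - regular_GL"
    obtain U V \<sigma> where svd: "is_svd U V \<sigma> M" and \<sigma>: "\<sigma> \<in> closed_weyl_chamber"
      using singular_value_decomposition[of M] unfolding is_svd_def by metis
    with M have "\<sigma> \<notin> weyl_chamber" using regular_GL_iff by blast
    with svd \<sigma> show "M \<in> {M. \<exists>U V. \<exists>\<sigma>\<in>closed_weyl_chamber - weyl_chamber. is_svd U V \<sigma> M}" by blast
  next
    fix M :: "('f, 'n::{finite,linorder}) sqmat"
    assume "M \<in> {M. \<exists>U V. \<exists>\<sigma>\<in>closed_weyl_chamber - weyl_chamber. is_svd U V \<sigma> M}"
    then show "M \<in> - regular_GL" using is_svd_unique regular_GL_iff by blast
  qed
  moreover have "closed (closed_weyl_chamber - weyl_chamber :: (real^'n::{finite,linorder}) set)"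
    by (intro closed_Diff closed_closed_weyl_chamber open_weyl_chamber)
  ultimately show ?thesis
    by (simp add: open_closed closed_svd_image)
qed

text \<open>By uniqueness, the preimage of a closed set \<open>B\<close> consists of the regular matrices that have a decomposition
  with singular values in \<open>B\<close> and the closed chamber.\<close>

lemma continuous_on_quotient_map:
  "continuous_on regular_GL (quotient_map_in_chart :: ('f::rch_algebra, 'n::{finite,linorder}) sqmat \<Rightarrow> _)"
  unfolding continuous_closedin_preimage_eq
proof (intro allI impI)
  fix B :: "(real^'n::{finite,linorder}) set" assume "closed B"
  let ?I = "{M :: ('f, 'n::{finite,linorder}) sqmat. \<exists>U V. \<exists>\<sigma>\<in>B \<inter> closed_weyl_chamber. is_svd U V \<sigma> M}"
  have "quotient_map_in_chart M \<in> B \<longleftrightarrow> M \<in> ?I" if M: "M \<in> regular_GL" for M :: "('f, 'n::{finite,linorder}) sqmat"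
    using quotient_map_svd[OF M] is_svd_unique weyl_chamber_subset_closed by blast
  then have "regular_GL \<inter> quotient_map_in_chart -` B = regular_GL \<inter> ?I" by blast
  moreover have "closed ?I"
    by (intro closed_svd_image closed_Int \<open>closed B\<close> closed_closed_weyl_chamber)
  ultimately show "closedin (top_of_set regular_GL)
      (regular_GL \<inter> (quotient_map_in_chart :: ('f, 'n::{finite,linorder}) sqmat \<Rightarrow> _) -` B)"
    by (simp add: closedin_closed_Int)
qed

lemma topspace_quotient_topology: "topspace (quotient_topology S p) = p ` S"
proof -
  have "openin (quotient_topology S p) (p ` S)"
    unfolding openin_quotient_topology by (simp add: conj_commute cong: conj_cong)
  then show ?thesis
    by (metis openin_quotient_topology openin_subset openin_topspace subset_antisym)
qed

text \<open>The chart is continuous because \<open>diag_mat\<close> is a continuous section of the quotient map, and open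
  because the quotient map is continuous when read in the chart.\<close>

lemma homeomorphic_weyl_chart:
  "homeomorphic_map (top_of_set weyl_chamber)
    (quotient_topology regular_GL (unitary_orbit :: ('f::rch_algebra, 'n::{finite,linorder}) sqmat \<Rightarrow> _)) weyl_chart"
  (is "homeomorphic_map ?X ?Y _")
proof (rule bijective_open_imp_homeomorphic_map)
  have chart: "weyl_chart \<sigma> = unitary_orbit (diag_mat \<sigma> :: ('f, 'n::{finite,linorder}) sqmat)" for \<sigma>
    by (simp add: weyl_chart_def)
  show img: "weyl_chart ` topspace ?X = topspace ?Y"
  proof (intro set_eqI iffI)
    fix O' :: "(('f, 'n::{finite,linorder}) sqmat) set"
    assume "O' \<in> weyl_chart ` topspace ?X"
    then show "O' \<in> topspace ?Y"
      using diag_mat_regular by (auto simp: topspace_quotient_topology chart)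
  next
    fix O' :: "(('f, 'n::{finite,linorder}) sqmat) set"
    assume "O' \<in> topspace ?Y"
    then show "O' \<in> weyl_chart ` topspace ?X"
      using quotient_map_svd by (fastforce simp: topspace_quotient_topology)
  qed
  show "inj_on weyl_chart (topspace ?X)" using inj_on_weyl_chart by simp
  show "continuous_map ?X ?Y weyl_chart"
    unfolding continuous_map_def
  proof (intro conjI allI impI)
    show "weyl_chart \<in> topspace ?X \<rightarrow> topspace ?Y" using img by blast
    fix B assume B: "openin ?Y B"
    let ?P = "{M \<in> regular_GL. unitary_orbit M \<in> B}"
    have "open ?P"
      using B by (simp add: openin_quotient_topology openin_open_eq[OF open_regular_GL])
    then have "open (diag_mat -` ?P)"
      by (intro open_vimage linear_continuous_on[OF bounded_linear_diag_mat])
    moreover have "{\<sigma> \<in> topspace ?X. weyl_chart \<sigma> \<in> B} = weyl_chamber \<inter> diag_mat -` ?P"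
      using diag_mat_regular by (auto simp: chart)
    ultimately show "openin ?X {\<sigma> \<in> topspace ?X. weyl_chart \<sigma> \<in> B}"
      by (simp add: openin_open_Int)
  qed
  show "open_map ?X ?Y weyl_chart"
    unfolding open_map_def
  proof (intro allI impI)
    fix B assume B: "openin ?X B"
    then have sub: "B \<subseteq> weyl_chamber" and "open B"
      by (simp_all add: openin_open_eq[OF open_weyl_chamber])
    have "unitary_orbit M \<in> weyl_chart ` B \<longleftrightarrow> quotient_map_in_chart M \<in> B"
      if "M \<in> regular_GL" for M :: "('f, 'n) sqmat"
      unfolding quotient_map_svd(3)[OF that]
      by (rule inj_on_image_mem_iff[OF inj_on_weyl_chart quotient_map_svd(1)[OF that] sub])
    then have "{M :: ('f, 'n) sqmat. M \<in> regular_GL \<and> unitary_orbit M \<in> weyl_chart ` B} = regular_GL \<inter> quotient_map_in_chart -` B"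
      by blast
    moreover have "openin (top_of_set regular_GL) (regular_GL \<inter> quotient_map_in_chart -` B)"
      using continuous_openin_preimage_gen[OF continuous_on_quotient_map \<open>open B\<close>] .
    moreover have "weyl_chart ` B \<subseteq> (unitary_orbit ` regular_GL :: ('f, 'n) sqmat set set)"
      using image_mono[OF sub, of "weyl_chart :: _ \<Rightarrow> ('f, 'n) sqmat set"] img by (simp add: topspace_quotient_topology)
    ultimately show "openin ?Y (weyl_chart ` B)"
      unfolding openin_quotient_topology by simp
  qed
qed

section \<open>Calculus of differentiability of finite order\<close>

lemma has_derivative_frechet:
  "f differentiable (at x) \<Longrightarrow> (f has_derivative frechet_derivative f (at x)) (at x)"
  by (simp add: frechet_derivative_works)

text \<open>On an open set, derivatives of all orders depend on the values in that set only.\<close>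

lemma Ck_on_cong:
  assumes "open S" "\<And>x. x \<in> S \<Longrightarrow> f x = g x"
  shows "Ck_on k S f \<longleftrightarrow> Ck_on k S g"
proof -
  have "Ck_on k S g" if "Ck_on k S f" "\<And>x. x \<in> S \<Longrightarrow> f x = g x" for f g
    using that
  proof (induction k arbitrary: f g)
    case 0
    then show ?case using continuous_on_cong[of S S f g] by simp
  next
    case (Suc k)
    have D: "(g has_derivative frechet_derivative f (at x)) (at x)" if "x \<in> S" for x
      using Suc.prems that
      by (intro has_derivative_transform_within_open[OF has_derivative_frechet \<open>open S\<close>]) auto
    then have "frechet_derivative f (at x) = frechet_derivative g (at x)" if "x \<in> S" for x
      using frechet_derivative_at that by blast
    with D Suc show ?case
      by (auto simp: differentiable_def intro: Suc.IH[of "\<lambda>x. frechet_derivative f (at x) v" for v])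
  qed
  from this[of f g] this[of g f] show ?thesis using assms by auto
qed

text \<open>The form in which the class is established: an explicit derivative takes the place of
  \<open>frechet_derivative\<close>.\<close>

lemma Ck_on_SucI:
  assumes "open S" "\<And>x. x \<in> S \<Longrightarrow> (f has_derivative D x) (at x)"
    "\<And>v. Ck_on k S (\<lambda>x. D x v)"
  shows "Ck_on (Suc k) S f"
proof -
  have "frechet_derivative f (at x) = D x" if "x \<in> S" for x
    using assms(2)[OF that] frechet_derivative_at by metis
  then have "Ck_on k S (\<lambda>x. frechet_derivative f (at x) v)" for v
    using assms(3) Ck_on_cong[OF \<open>open S\<close>, of "\<lambda>x. D x v" "\<lambda>x. frechet_derivative f (at x) v" k] by simp
  then show ?thesis using assms(2) by (auto simp: differentiable_def)
qed

lemma Ck_on_SucD: "Ck_on (Suc k) S f \<Longrightarrow> Ck_on k S f"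
proof (induction k arbitrary: f)
  case 0
  then show ?case
    by (auto simp: continuous_on_eq_continuous_within intro: differentiable_imp_continuous_within
        differentiable_at_withinI)
next
  case (Suc k)
  then show ?case by (metis Ck_on.simps(2))
qed

lemma Ck_on_const: "Ck_on k S (\<lambda>x. c)"
  by (induction k arbitrary: c) simp_all

lemma Ck_on_bounded_linear:
  assumes "bounded_linear L" "open S" "Ck_on k S f"
  shows "Ck_on k S (\<lambda>x. L (f x))"
  using assms(3)
proof (induction k arbitrary: f)
  case 0
  then show ?case using bounded_linear.continuous_on[OF assms(1)] by simp
next
  case (Suc k)
  show ?case
    by (rule Ck_on_SucI[OF \<open>open S\<close> bounded_linear.has_derivative[OF assms(1) has_derivative_frechet]])
      (use Suc in auto)
qed

lemma Ck_on_ident: "open S \<Longrightarrow> Ck_on k S (\<lambda>x. x)"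
  by (cases k) (auto intro!: Ck_on_SucI[where D = "\<lambda>_ v. v"] Ck_on_const)

lemma Ck_on_add:
  assumes "open S" "Ck_on k S f" "Ck_on k S g"
  shows "Ck_on k S (\<lambda>x. f x + g x)"
  using assms(2,3)
proof (induction k arbitrary: f g)
  case 0
  then show ?case by (auto intro: continuous_intros)
next
  case (Suc k)
  show ?case
    by (rule Ck_on_SucI[OF \<open>open S\<close> has_derivative_add[OF has_derivative_frechet has_derivative_frechet]])
      (use Suc in auto)
qed

lemma Ck_on_sum:
  assumes "open S" "\<And>i. i \<in> I \<Longrightarrow> Ck_on k S (f i)"
  shows "Ck_on k S (\<lambda>x. \<Sum>i\<in>I. f i x)"
  using assms(2) by (induction I rule: infinite_finite_induct) (auto intro!: Ck_on_const Ck_on_add[OF assms(1)])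

lemma Ck_on_minus: "open S \<Longrightarrow> Ck_on k S f \<Longrightarrow> Ck_on k S (\<lambda>x. - f x)"
  by (rule Ck_on_bounded_linear[OF bounded_linear_minus[OF bounded_linear_ident]])

lemma Ck_on_diff: "open S \<Longrightarrow> Ck_on k S f \<Longrightarrow> Ck_on k S g \<Longrightarrow> Ck_on k S (\<lambda>x. f x - g x)"
  using Ck_on_add[of S k f "\<lambda>x. - g x"] Ck_on_minus[of S k g] by simp

lemma Ck_on_bilinear:
  assumes "bounded_bilinear B" "open S" "Ck_on k S f" "Ck_on k S g"
  shows "Ck_on k S (\<lambda>x. B (f x) (g x))"
  using assms(3,4)
proof (induction k arbitrary: f g)
  case 0
  then show ?case using bounded_bilinear.continuous_on[OF assms(1)] by simp
next
  case (Suc k)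
  show ?case
  proof (rule Ck_on_SucI[OF \<open>open S\<close> bounded_bilinear.FDERIV[OF assms(1) has_derivative_frechet has_derivative_frechet]])
    show "Ck_on k S (\<lambda>x. B (f x) (frechet_derivative g (at x) v) + B (frechet_derivative f (at x) v) (g x))" for v
      using Suc.prems Ck_on_SucD[OF Suc.prems(1)] Ck_on_SucD[OF Suc.prems(2)]
      by (intro Ck_on_add Suc.IH \<open>open S\<close>) auto
  qed (use Suc.prems in auto)
qed

text \<open>Bootstrapping: the derivative of the reciprocal is a polynomial in the reciprocal and the
  derivative of the function.\<close>

lemma Ck_on_inverse:
  fixes f :: "'a::real_normed_vector \<Rightarrow> real"
  assumes "open S" "Ck_on k S f" "\<And>x. x \<in> S \<Longrightarrow> f x \<noteq> 0"
  shows "Ck_on k S (\<lambda>x. inverse (f x))"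
  using assms(2)
proof (induction k)
  case 0
  then show ?case using assms(3) by (auto intro: continuous_intros)
next
  case (Suc k)
  show ?case
  proof (rule Ck_on_SucI[OF \<open>open S\<close> Deriv.has_derivative_inverse[OF _ has_derivative_frechet]])
    show "Ck_on k S (\<lambda>x. - (inverse (f x) * frechet_derivative f (at x) v * inverse (f x)))" for v
      using Suc Ck_on_SucD[of k S f] 
      by (intro Ck_on_minus Ck_on_bilinear[OF bounded_bilinear_mult] \<open>open S\<close> Suc.IH) auto
  qed (use Suc assms in auto)
qed

text \<open>Caratheodory's criterion: it suffices to write the increment as a linear map applied to \<open>y - x\<close>
  that depends continuously on \<open>y\<close>. In finite dimension pointwise convergence of the linear maps is
  enough, since it bounds their norms on a basis.\<close>

lemma has_derivative_Caratheodory: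
  fixes f :: "'a::euclidean_space \<Rightarrow> 'b::real_normed_vector"
  assumes ev: "\<forall>\<^sub>F y in at x. linear (\<Phi> y) \<and> f y - f x = \<Phi> y (y - x)"
    and lim: "\<And>v. ((\<lambda>y. \<Phi> y v) \<longlongrightarrow> \<Phi> x v) (at x)" and lin: "linear (\<Phi> x)"
  shows "(f has_derivative \<Phi> x) (at x)"
proof -
  have bl: "bounded_linear (\<Phi> x)" using lin linear_conv_bounded_linear by blast
  define e where "e y = (\<Sum>b\<in>Basis. norm (\<Phi> y b - \<Phi> x b))" for y
  have "((\<lambda>y. norm (\<Phi> y b - \<Phi> x b)) \<longlongrightarrow> 0) (at x)" for b
    using lim[of b] LIM_zero tendsto_norm_zero by blast
  then have e: "(e \<longlongrightarrow> 0) (at x)"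
    unfolding e_def using tendsto_sum[of Basis "\<lambda>b y. norm (\<Phi> y b - \<Phi> x b)" "\<lambda>_. 0" "at x"] by simp
  have "norm ((f y - f x - \<Phi> x (y - x)) /\<^sub>R norm (y - x)) \<le> e y"
    if y: "linear (\<Phi> y)" "f y - f x = \<Phi> y (y - x)" for y
  proof -
    have L: "linear (\<lambda>v. \<Phi> y v - \<Phi> x v)" using y(1) lin by (rule linear_compose_sub)
    define v where "v = y - x"
    have "\<Phi> y v - \<Phi> x v = (\<Sum>b\<in>Basis. inner v b *\<^sub>R (\<Phi> y b - \<Phi> x b))"
      using linear_sum[OF L, of "\<lambda>b. inner v b *\<^sub>R b" Basis] linear_scale[OF L]
      by (simp add: euclidean_representation)
    also have "norm \<dots> \<le> (\<Sum>b\<in>Basis. norm v * norm (\<Phi> y b - \<Phi> x b))"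
      by (rule sum_norm_le) (simp add: Basis_le_norm mult_right_mono)
    finally have "norm (\<Phi> y (y - x) - \<Phi> x (y - x)) \<le> norm (y - x) * e y"
      unfolding e_def sum_distrib_left v_def .
    then have "norm (\<Phi> y (y - x) - \<Phi> x (y - x)) / norm (y - x) \<le> e y"
      by (cases "y = x") (simp_all add: divide_le_eq mult.commute e_def sum_nonneg)
    then show ?thesis unfolding y(2) norm_scaleR by (simp add: divide_inverse mult.commute)
  qed
  then have "\<forall>\<^sub>F y in at x. norm ((f y - f x - \<Phi> x (y - x)) /\<^sub>R norm (y - x)) \<le> e y"
    using ev by (auto elim: eventually_mono)
  then have "((\<lambda>y. (f y - f x - \<Phi> x (y - x)) /\<^sub>R norm (y - x)) \<longlongrightarrow> 0) (at x)"
    by (rule Lim_null_comparison[OF _ e])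
  then show ?thesis using bl by (simp add: has_derivative_def)
qed

section \<open>Spectral projections and the derivative of the singular values\<close>

text \<open>The orthogonal projection to the \<open>i\<close>-th eigenspace of \<open>M\<^sup>* M\<close>. The choice of \<open>V\<close> is immaterial, but
  only the algebraic relations below are used, and these hold for every choice.\<close>

definition spectral_proj :: "'n \<Rightarrow> ('f::rch_algebra, 'n::{finite,linorder}) sqmat \<Rightarrow> ('f, 'n) sqmat"
  where "spectral_proj i M =
    (let V = SOME V. \<exists>U. is_svd U V (quotient_map_in_chart M) M
     in V ** diag_mat (axis i 1) ** ctranspose V)"

abbreviation sv :: "'n \<Rightarrow> ('f::rch_algebra, 'n::{finite,linorder}) sqmat \<Rightarrow> real"
  where "sv i M \<equiv> quotient_map_in_chart M $ i"

lemma spectral_proj_from_svd: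
  assumes "M \<in> regular_GL"
  obtains U V where "is_svd U V (quotient_map_in_chart M) M"
    "\<And>i. spectral_proj i M = V ** diag_mat (axis i 1) ** ctranspose V"
proof -
  define V where "V = (SOME V. \<exists>U. is_svd U V (quotient_map_in_chart M) M)"
  have "\<exists>V U. is_svd U V (quotient_map_in_chart M) M"
    using quotient_map_svd(2)[OF assms] by blast
  then obtain U where "is_svd U V (quotient_map_in_chart M) M"
    unfolding V_def by (rule exE[OF someI_ex])
  then show thesis by (rule that) (simp add: spectral_proj_def V_def Let_def)
qed

lemma sv_pos: "(M :: ('f::rch_algebra, 'n::{finite,linorder}) sqmat) \<in> regular_GL \<Longrightarrow> 0 < sv i M"
  using quotient_map_svd(1)[of M] by (simp add: weyl_chamber_def)

text \<open>The spectral gaps: denominators in the formulas below.\<close>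

lemma sv_distinct:
  fixes M :: "('f::rch_algebra, 'n::{finite,linorder}) sqmat"
  assumes "M \<in> regular_GL" "i \<noteq> j"
  shows "(sv i M)\<^sup>2 \<noteq> (sv j M)\<^sup>2"
proof -
  have "sv i M \<noteq> sv j M"
    using inj_weyl_chamber[OF quotient_map_svd(1)[OF assms(1)]] assms(2) by (auto dest: injD)
  then show ?thesis
    using sv_pos[OF assms(1), of i] sv_pos[OF assms(1), of j]
    by (simp add: power2_eq_iff_nonneg less_imp_le)
qed

lemma diag_axis_mult:
  "diag_mat (axis i 1) ** diag_mat (axis j 1) = (if i = j then diag_mat (axis i 1) else 0 :: ('f::rch_algebra)^'n^'n)"
  by (auto simp: vec_eq_iff diag_mat_mult_nth diag_mat_nth axis_def)

lemma
  fixes M :: "('f::rch_algebra, 'n::{finite,linorder}) sqmat"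
  assumes "M \<in> regular_GL"
  shows spectral_proj_mult:
      "spectral_proj i M ** spectral_proj j M = (if i = j then spectral_proj i M else 0)"
    and ctranspose_spectral_proj: "ctranspose (spectral_proj i M) = spectral_proj i M"
    and sum_spectral_proj: "(\<Sum>i\<in>UNIV. spectral_proj i M) = mat 1"
    and gram_spectral_proj: "ctranspose M ** M ** spectral_proj i M = (sv i M)\<^sup>2 *\<^sub>R spectral_proj i M"
    and spectral_proj_gram: "spectral_proj i M ** (ctranspose M ** M) = (sv i M)\<^sup>2 *\<^sub>R spectral_proj i M"
    and inner_spectral_proj:
      "inner (spectral_proj i M) (spectral_proj j M) = (if i = j then 1 else 0)"
proof -
  obtain U V where svd: "is_svd U V (quotient_map_in_chart M) M"
    and P: "\<And>i. spectral_proj i M = V ** diag_mat (axis i 1) ** ctranspose V"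
    by (rule spectral_proj_from_svd[OF assms]) blast
  have V: "V \<in> unitary_group" using svd by (simp add: is_svd_def)
  \<comment> \<open>Conjugation by \<open>V\<close> is multiplicative and isometric, so everything reduces to diagonal matrices.\<close>
  have conj_mult: "(V ** A ** ctranspose V) ** (V ** B ** ctranspose V) = V ** (A ** B) ** ctranspose V" for A B
    by (simp add: matrix_mul_assoc[symmetric] unitary_cancel[OF V])
  show "spectral_proj i M ** spectral_proj j M = (if i = j then spectral_proj i M else 0)"
    by (simp add: P conj_mult diag_axis_mult)
  show "ctranspose (spectral_proj i M) = spectral_proj i M"
    by (simp add: P ctranspose_mult matrix_mul_assoc)
  have "(\<Sum>i\<in>UNIV. diag_mat (axis i (1::real))) = (diag_mat (\<Sum>i\<in>UNIV. axis i 1) :: ('f, 'n) sqmat)"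
    by (rule linear_sum[OF linear_diag_mat, symmetric])
  also have "(\<Sum>i\<in>UNIV. axis i (1::real)) = (\<chi> i. 1)"
    by (simp add: vec_eq_iff axis_def)
  finally have "(\<Sum>i\<in>UNIV. diag_mat (axis i (1::real))) = (mat 1 :: ('f, 'n) sqmat)"
    by (simp only: diag_mat_one)
  then show "(\<Sum>i\<in>UNIV. spectral_proj i M) = mat 1"
    by (simp add: P unitary_groupD[OF V] flip: matmul.sum_left matmul.sum_right)
  have "diag_mat (\<chi> i. sv i M * sv i M) ** diag_mat (axis i 1) = (sv i M)\<^sup>2 *\<^sub>R (diag_mat (axis i 1) :: ('f, 'n) sqmat)"
    "diag_mat (axis i 1) ** diag_mat (\<chi> i. sv i M * sv i M) = (sv i M)\<^sup>2 *\<^sub>R (diag_mat (axis i 1) :: ('f, 'n) sqmat)"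
    by (auto simp: vec_eq_iff diag_mat_mult_nth mult_diag_mat_nth diag_mat_nth axis_def power2_eq_square of_real_def)
  then show "ctranspose M ** M ** spectral_proj i M = (sv i M)\<^sup>2 *\<^sub>R spectral_proj i M"
    "spectral_proj i M ** (ctranspose M ** M) = (sv i M)\<^sup>2 *\<^sub>R spectral_proj i M"
    by (simp_all add: is_svd_gram[OF svd] P conj_mult matmul.scaleR_left matmul.scaleR_right)
  have "inner (spectral_proj i M) (spectral_proj j M) = inner (axis i (1::real)) (axis j 1)"
    unfolding P inner_sandwich
    by (simp add: matrix_mul_assoc[symmetric] unitary_cancel[OF V] unitary_groupD[OF V] inner_diag_mat)
  then show "inner (spectral_proj i M) (spectral_proj j M) = (if i = j then 1 else 0)"
    by (simp add: inner_axis_axis)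
qed

lemma norm_spectral_proj: "M \<in> regular_GL \<Longrightarrow> norm (spectral_proj i M) = 1"
  by (simp add: norm_eq_sqrt_inner inner_spectral_proj)

text \<open>Linear in \<open>v\<close>; at \<open>v = y - x\<close> it is the exact increment of the Gram matrix \<open>M\<^sup>* M\<close> from \<open>x\<close> to \<open>y\<close>, and
  at \<open>y = x\<close> it is the derivative of the Gram matrix.\<close>

definition gram_increment :: "'f::rch_algebra^'n^'n \<Rightarrow> 'f^'n^'n \<Rightarrow> 'f^'n^'n \<Rightarrow> 'f^'n^'n"
  where "gram_increment x y v = ctranspose y ** v + ctranspose v ** x"

lemma gram_increment_diff:
  "gram_increment x y (y - x) = ctranspose y ** y - ctranspose x ** x"
  by (simp add: gram_increment_def matmul.diff_left matmul.diff_right linear_diff[OF linear_ctranspose])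

lemma linear_gram_increment: "linear (gram_increment x y)"
  by (rule linearI)
    (simp_all add: gram_increment_def matmul.add_left matmul.add_right matmul.scaleR_left matmul.scaleR_right
      linear_add[OF linear_ctranspose] linear_scale[OF linear_ctranspose] scaleR_right_distrib)

text \<open>The difference of \<open>H(y) P\<^sub>i(y) = \<sigma>\<^sub>i(y)\<^sup>2 P\<^sub>i(y)\<close> and \<open>P\<^sub>j(x) H(x) = \<sigma>\<^sub>j(x)\<^sup>2 P\<^sub>j(x)\<close>, each multiplied by the
  other projection.\<close>

lemma spectral_proj_increment:
  assumes x: "x \<in> regular_GL" and y: "y \<in> regular_GL"
  shows "spectral_proj j x ** gram_increment x y (y - x) ** spectral_proj i y =
    ((sv i y)\<^sup>2 - (sv j x)\<^sup>2) *\<^sub>R (spectral_proj j x ** spectral_proj i y)"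
proof -
  have "spectral_proj j x ** gram_increment x y (y - x) ** spectral_proj i y
     = spectral_proj j x ** (ctranspose y ** y ** spectral_proj i y)
       - spectral_proj j x ** (ctranspose x ** x) ** spectral_proj i y"
    by (simp add: gram_increment_diff matmul.diff_left matmul.diff_right matrix_mul_assoc)
  then show ?thesis
    by (simp add: gram_spectral_proj[OF y] spectral_proj_gram[OF x] matmul.scaleR_left matmul.scaleR_right
        scaleR_left_diff_distrib)
qed

text \<open>At \<open>y = x\<close> this is the first order perturbation formula for spectral projections; for general \<open>y\<close>
  it is a difference quotient in the sense of Caratheodory.\<close>

definition spectral_proj_slope ::
    "'n \<Rightarrow> ('f::rch_algebra, 'n::{finite,linorder}) sqmat \<Rightarrow> ('f, 'n) sqmat \<Rightarrow> ('f, 'n) sqmat \<Rightarrow> ('f, 'n) sqmat"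
  where "spectral_proj_slope i x y v = (\<Sum>j\<in>-{i}.
     (spectral_proj j x ** gram_increment x y v ** spectral_proj i y) /\<^sub>R ((sv i y)\<^sup>2 - (sv j x)\<^sup>2)
   - (spectral_proj i x ** gram_increment x y v ** spectral_proj j y) /\<^sub>R ((sv j y)\<^sup>2 - (sv i x)\<^sup>2))"

lemma linear_spectral_proj_slope: "linear (spectral_proj_slope i x y)"
  by (rule linearI)
    (simp_all add: spectral_proj_slope_def linear_add[OF linear_gram_increment] linear_scale[OF linear_gram_increment]
      matmul.add_left matmul.add_right matmul.scaleR_left matmul.scaleR_right
      scaleR_right_distrib scaleR_right_diff_distrib sum.distrib sum_subtractf scaleR_sum_right mult.commute)

text \<open>Expand \<open>P\<^sub>i(y)\<close> by the resolution of the identity at \<open>x\<close>, and \<open>P\<^sub>i(x)\<close> by the one at \<open>y\<close>. The terms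
  \<open>P\<^sub>i(x) P\<^sub>i(y)\<close> of index \<open>i\<close> cancel, and all others have a spectral gap to divide by.\<close>

lemma spectral_proj_diff:
  assumes x: "x \<in> regular_GL" and y: "y \<in> regular_GL"
    and gap: "\<And>i j. i \<noteq> j \<Longrightarrow> (sv i y)\<^sup>2 \<noteq> (sv j x)\<^sup>2"
  shows "spectral_proj i y - spectral_proj i x = spectral_proj_slope i x y (y - x)"
proof -
  have split: "(\<Sum>j\<in>UNIV. a j) = a i + (\<Sum>j\<in>-{i}. a j)" for a :: "'b \<Rightarrow> ('a, 'b) sqmat"
    by (subst sum.remove[of UNIV i]) (simp_all add: Compl_eq_Diff_UNIV)
  have "spectral_proj i y = (\<Sum>j\<in>UNIV. spectral_proj j x ** spectral_proj i y)"
    by (simp add: sum_spectral_proj[OF x] flip: matmul.sum_left)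
  moreover have "spectral_proj i x = (\<Sum>j\<in>UNIV. spectral_proj i x ** spectral_proj j y)"
    by (simp add: sum_spectral_proj[OF y] flip: matmul.sum_right)
  ultimately have "spectral_proj i y - spectral_proj i x
    = (\<Sum>j\<in>-{i}. spectral_proj j x ** spectral_proj i y - spectral_proj i x ** spectral_proj j y)"
    unfolding split by (simp add: sum_subtractf) (metis add_diff_cancel_left)
  also have "\<dots> = spectral_proj_slope i x y (y - x)"
    unfolding spectral_proj_slope_def
  proof (rule sum.cong[OF refl])
    fix j assume "j \<in> -{i}"
    then show "spectral_proj j x ** spectral_proj i y - spectral_proj i x ** spectral_proj j y =
      (spectral_proj j x ** gram_increment x y (y - x) ** spectral_proj i y) /\<^sub>R ((sv i y)\<^sup>2 - (sv j x)\<^sup>2)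
      - (spectral_proj i x ** gram_increment x y (y - x) ** spectral_proj j y) /\<^sub>R ((sv j y)\<^sup>2 - (sv i x)\<^sup>2)"
      using gap[of i j] gap[of j i] by (simp add: spectral_proj_increment[OF x y])
  qed
  finally show ?thesis .
qed

context
  fixes x :: "('f::rch_algebra, 'n::{finite,linorder}) sqmat"
  assumes x: "x \<in> regular_GL"
begin

lemma eventually_regular: "\<forall>\<^sub>F y in at x. y \<in> regular_GL"
  using eventually_at_in_open'[OF open_regular_GL x] .

lemma tendsto_sv: "((\<lambda>y. sv i y) \<longlongrightarrow> sv i x) (at x)"
proof -
  have "isCont quotient_map_in_chart x"
    using continuous_on_quotient_map x open_regular_GL continuous_on_eq_continuous_at by blast
  then show ?thesis by (auto simp: isCont_def intro!: tendsto_vec_nth)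
qed

lemma eventually_gap: "\<forall>\<^sub>F y in at x. \<forall>i j. i \<noteq> j \<longrightarrow> (sv i y)\<^sup>2 \<noteq> (sv j x)\<^sup>2"
proof -
  have "\<forall>\<^sub>F y in at x. (sv i y)\<^sup>2 \<noteq> (sv j x)\<^sup>2" if "i \<noteq> j" for i j
    using tendsto_imp_eventually_ne[OF tendsto_power[OF tendsto_sv] sv_distinct[OF x that]] .
  then show ?thesis by (simp add: eventually_all_finite)
qed

lemma tendsto_gram_increment:
  assumes "(v \<longlongrightarrow> w) (at x)"
  shows "((\<lambda>y. gram_increment x y (v y)) \<longlongrightarrow> gram_increment x x w) (at x)"
  unfolding gram_increment_def
  by (intro tendsto_add matmul.tendsto bounded_linear.tendsto[OF bounded_linear_ctranspose] tendsto_ident_at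
      tendsto_const assms)

text \<open>Continuity is forced by the identity for the increment: the projections have norm one, the spectral
  gaps stay away from zero, and the increment of the Gram matrix tends to zero.\<close>

lemma tendsto_spectral_proj: "(spectral_proj i \<longlongrightarrow> spectral_proj i x) (at x)"
proof -
  have Bfun: "Bfun (spectral_proj i) (at x)" for i
    by (rule BfunI[of _ 1], rule eventually_mono[OF eventually_regular]) (simp add: norm_spectral_proj)
  have "((\<lambda>y. gram_increment x y (y - x)) \<longlongrightarrow> gram_increment x x (x - x)) (at x)"
    by (intro tendsto_gram_increment tendsto_intros)
  moreover have "gram_increment x x (x - x) = 0"
    using linear_0[OF linear_gram_increment[of x x]] by simp
  ultimately have inc: "((\<lambda>y. gram_increment x y (y - x)) \<longlongrightarrow> 0) (at x)" by simp
  have "((\<lambda>y. (A ** gram_increment x y (y - x)) ** spectral_proj j y) \<longlongrightarrow> 0) (at x)" for A j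
  proof -
    have "((\<lambda>y. A ** gram_increment x y (y - x)) \<longlongrightarrow> A ** 0) (at x)"
      by (intro matmul.tendsto tendsto_const inc)
    then have "Zfun (\<lambda>y. A ** gram_increment x y (y - x)) (at x)"
      by (simp add: tendsto_Zfun_iff)
    from matmul.Zfun_prod_Bfun[OF this Bfun] show ?thesis
      by (simp add: tendsto_Zfun_iff)
  qed
  moreover have "((\<lambda>y. inverse ((sv i y)\<^sup>2 - (sv j x)\<^sup>2)) \<longlongrightarrow> inverse ((sv i x)\<^sup>2 - (sv j x)\<^sup>2)) (at x)"
    if "i \<noteq> j" for i j
    using sv_distinct[OF x that] by (intro tendsto_intros tendsto_sv) simp
  ultimately have "((\<lambda>y. spectral_proj_slope i x y (y - x))
      \<longlongrightarrow> (\<Sum>j\<in>-{i}. inverse ((sv i x)\<^sup>2 - (sv j x)\<^sup>2) *\<^sub>R 0 - inverse ((sv j x)\<^sup>2 - (sv i x)\<^sup>2) *\<^sub>R 0)) (at x)"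
    unfolding spectral_proj_slope_def by (intro tendsto_sum tendsto_diff tendsto_scaleR) auto
  then have "((\<lambda>y. spectral_proj_slope i x y (y - x)) \<longlongrightarrow> 0) (at x)" by simp
  moreover have "\<forall>\<^sub>F y in at x. spectral_proj_slope i x y (y - x) = spectral_proj i y - spectral_proj i x"
    using eventually_regular eventually_gap by eventually_elim (simp add: spectral_proj_diff[OF x])
  ultimately have "((\<lambda>y. spectral_proj i y - spectral_proj i x) \<longlongrightarrow> 0) (at x)"
    by (rule Lim_transform_eventually)
  then show ?thesis by (simp add: LIM_zero_iff)
qed

lemma has_derivative_spectral_proj:
  "(spectral_proj i has_derivative spectral_proj_slope i x x) (at x)"
proof (rule has_derivative_Caratheodory[where \<Phi> = "spectral_proj_slope i x"])
  show "\<forall>\<^sub>F y in at x. linear (spectral_proj_slope i x y) \<and>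
      spectral_proj i y - spectral_proj i x = spectral_proj_slope i x y (y - x)"
    using eventually_regular eventually_gap
    by eventually_elim (simp add: spectral_proj_diff[OF x] linear_spectral_proj_slope)
  show "((\<lambda>y. spectral_proj_slope i x y v) \<longlongrightarrow> spectral_proj_slope i x x v) (at x)" for v
    unfolding spectral_proj_slope_def
    by (intro tendsto_sum tendsto_diff tendsto_scaleR tendsto_inverse matmul.tendsto tendsto_gram_increment
       tendsto_const tendsto_power tendsto_sv tendsto_spectral_proj) (auto dest: sv_distinct[OF x])
qed (rule linear_spectral_proj_slope)

text \<open>The increment identity with \<open>j = i\<close>, paired with the identity matrix, gives the increment of \<open>\<sigma>\<^sub>i\<^sup>2\<close>
  times the inner product of \<open>P\<^sub>i(x)\<close> and \<open>P\<^sub>i(y)\<close>, and the latter tends to one. The factor \<open>2\<close> of the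
  square cancels with the two equal terms of the derivative of \<open>M\<^sup>* M\<close>.\<close>

lemma has_derivative_sv:
  "((\<lambda>M. sv i M) has_derivative (\<lambda>v. inner v (x ** spectral_proj i x) / sv i x)) (at x)"
proof -
  \<comment> \<open>Caratheodory slope: divide by the inner product and by the cofactor of
    \<open>\<sigma>\<^sub>i(y)\<^sup>2 - \<sigma>\<^sub>i(x)\<^sup>2\<close>.\<close>
  define \<Phi> where "\<Phi> y v = inner (gram_increment x y v ** spectral_proj i y) (spectral_proj i x)
      / (inner (spectral_proj i y) (spectral_proj i x) * (sv i y + sv i x))" for y v
  have lin: "linear (\<Phi> y)" for y
    by (rule linearI) (simp_all add: \<Phi>_def linear_add[OF linear_gram_increment] linear_scale[OF linear_gram_increment]
        matmul.add_left matmul.scaleR_left inner_add_left add_divide_distrib)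
  have ip: "((\<lambda>y. inner (spectral_proj i y) (spectral_proj i x)) \<longlongrightarrow> 1) (at x)"
    using tendsto_inner[OF tendsto_spectral_proj tendsto_const, of i "spectral_proj i x"] by (simp add: inner_spectral_proj[OF x])
  then have "\<forall>\<^sub>F y in at x. inner (spectral_proj i y) (spectral_proj i x) \<noteq> 0"
    by (rule tendsto_imp_eventually_ne) simp
  then have ev: "\<forall>\<^sub>F y in at x. linear (\<Phi> y) \<and> sv i y - sv i x = \<Phi> y (y - x)"
    using eventually_regular
  proof eventually_elim
    case (elim y)
    have "inner (ctranspose x ** x ** spectral_proj i y) (spectral_proj i x)
        = inner (spectral_proj i y) (ctranspose x ** x ** spectral_proj i x)"
      by (simp add: inner_matrix_mult_left[of "ctranspose x ** x"] ctranspose_mult)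
    then have "inner (gram_increment x y (y - x) ** spectral_proj i y) (spectral_proj i x)
      = ((sv i y)\<^sup>2 - (sv i x)\<^sup>2) * inner (spectral_proj i y) (spectral_proj i x)"
      by (simp add: gram_increment_diff matmul.diff_left inner_diff_left gram_spectral_proj[OF x]
          gram_spectral_proj[OF elim(2)] left_diff_distrib)
    moreover have "0 < sv i y + sv i x" using sv_pos[OF x] sv_pos[OF elim(2)] by (simp add: add_pos_pos)
    moreover have "(sv i y)\<^sup>2 - (sv i x)\<^sup>2 = (sv i y - sv i x) * (sv i y + sv i x)"
      by (simp add: power2_eq_square algebra_simps)
    ultimately show ?case
      using elim(1) lin by (simp add: \<Phi>_def)
  qed
  have "(( \<lambda>y. \<Phi> y v) \<longlongrightarrow> \<Phi> x v) (at x)" for v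
    unfolding \<Phi>_def using sv_pos[OF x, of i]
    by (intro tendsto_intros matmul.tendsto tendsto_gram_increment tendsto_spectral_proj tendsto_sv)
      (simp add: inner_spectral_proj[OF x])
  with ev have "((\<lambda>M. sv i M) has_derivative \<Phi> x) (at x)"
    using lin by (intro has_derivative_Caratheodory[where \<Phi> = \<Phi>])
  moreover have "\<Phi> x = (\<lambda>v. inner v (x ** spectral_proj i x) / sv i x)"
  proof
    fix v
    let ?P = "spectral_proj i x"
    have PP: "?P ** ?P = ?P" "ctranspose ?P = ?P"
      by (simp_all add: spectral_proj_mult[OF x] ctranspose_spectral_proj[OF x])
    have "inner (v ** ?P) (x ** ?P) = inner v (x ** ?P)"
      by (simp add: inner_matrix_mult_right[of v] PP matrix_mul_assoc[symmetric])
    moreover have "inner (ctranspose x ** v ** ?P) ?P = inner (v ** ?P) (x ** ?P)"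
      by (simp add: matrix_mul_assoc[symmetric] inner_matrix_mult_left[of "ctranspose x"])
    moreover have "inner (ctranspose v ** x ** ?P) ?P = inner (v ** ?P) (x ** ?P)"
      using inner_matrix_mult_left[of "ctranspose v" "x ** ?P" ?P]
      by (simp add: matrix_mul_assoc inner_commute[of "x ** ?P"])
    ultimately show "\<Phi> x v = inner v (x ** ?P) / sv i x"
      by (simp add: \<Phi>_def gram_increment_def matmul.add_left inner_add_left inner_spectral_proj[OF x])
  qed
  ultimately show ?thesis by simp
qed

end

lemmas Ck_on_regular_intros =
  Ck_on_const Ck_on_ident[OF open_regular_GL] Ck_on_add[OF open_regular_GL] Ck_on_diff[OF open_regular_GL]
  Ck_on_sum[OF open_regular_GL] Ck_on_bounded_linear[OF bounded_linear_ctranspose open_regular_GL]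
  Ck_on_bilinear[OF matmul.bounded_bilinear_axioms open_regular_GL]
  Ck_on_bilinear[OF bounded_bilinear_inner open_regular_GL]
  Ck_on_bilinear[OF bounded_bilinear_mult open_regular_GL]
  Ck_on_bilinear[OF bounded_bilinear_scaleR open_regular_GL]
  Ck_on_inverse[OF open_regular_GL]

text \<open>The singular values and the spectral projections form a closed system: the first derivatives are
  rational in the same functions, with denominators that do not vanish, so each differentiation
  gains one order.\<close>

lemma Ck_on_sv_spectral_proj:
  "(\<forall>i. Ck_on k regular_GL (\<lambda>M :: ('f::rch_algebra, 'n::{finite,linorder}) sqmat. sv i M)) \<and>
   (\<forall>i. Ck_on k regular_GL (spectral_proj i :: ('f, 'n) sqmat \<Rightarrow> ('f, 'n) sqmat))"
proof (induction k)
  case 0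
  show ?case
    by (simp add: continuous_on_eq_continuous_at[OF open_regular_GL] isCont_def
        tendsto_sv tendsto_spectral_proj)
next
  case (Suc k)
  then have s: "Ck_on k regular_GL (\<lambda>M :: ('f, 'n) sqmat. sv i M)"
    and p: "Ck_on k regular_GL (spectral_proj i :: ('f, 'n) sqmat \<Rightarrow> ('f, 'n) sqmat)" for i by auto
  have "Ck_on (Suc k) regular_GL (\<lambda>M :: ('f, 'n) sqmat. sv i M)" for i
  proof (rule Ck_on_SucI[OF open_regular_GL has_derivative_sv])
    fix v :: "('f, 'n) sqmat"
    show "Ck_on k regular_GL (\<lambda>x. inner v (x ** spectral_proj i x) / sv i x)"
      unfolding divide_inverse
      by (intro Ck_on_regular_intros s p) (use sv_pos[where 'f = 'f and 'n = 'n] in \<open>simp add: less_imp_neq[symmetric]\<close>)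
  qed
  moreover have "Ck_on (Suc k) regular_GL (spectral_proj i :: ('f, 'n) sqmat \<Rightarrow> ('f, 'n) sqmat)" for i
  proof (rule Ck_on_SucI[OF open_regular_GL has_derivative_spectral_proj])
    fix v :: "('f, 'n) sqmat"
    show "Ck_on k regular_GL (\<lambda>x. spectral_proj_slope i x x v)"
      unfolding spectral_proj_slope_def gram_increment_def power2_eq_square
      by (intro Ck_on_regular_intros s p)
        (use sv_distinct[where 'f = 'f and 'n = 'n, unfolded power2_eq_square] in auto)
  qed
  ultimately show ?case by blast
qed

section \<open>Horizontal lifts and the quotient metric\<close>

text \<open>The inverse as \<open>(M\<^sup>* M)\<^sup>-\<^sup>1 M\<^sup>*\<close>, expanded in the spectral decomposition. This shows that it depends
  smoothly on \<open>M\<close>.\<close>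

lemma matrix_inv_regular:
  fixes M :: "('f::rch_algebra, 'n::{finite,linorder}) sqmat"
  assumes M: "M \<in> regular_GL"
  shows "matrix_inv M = (\<Sum>i\<in>UNIV. inverse ((sv i M)\<^sup>2) *\<^sub>R (spectral_proj i M ** ctranspose M))"
    and "matrix_inv M ** M = mat 1" and "M ** matrix_inv M = mat 1"
proof -
  let ?N = "\<Sum>i\<in>UNIV. inverse ((sv i M)\<^sup>2) *\<^sub>R (spectral_proj i M ** ctranspose M)"
  have "inverse ((sv i M)\<^sup>2) *\<^sub>R (spectral_proj i M ** ctranspose M) ** M = spectral_proj i M" for i
    using sv_pos[OF M, of i]
    by (simp add: matmul.scaleR_left matrix_mul_assoc[symmetric] spectral_proj_gram[OF M])
  then have "?N ** M = mat 1"
    by (simp add: matmul.sum_left sum_spectral_proj[OF M])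
  moreover from this have "M ** ?N = mat 1" by (rule matrix_left_inverse_if_right_inverse)
  ultimately show inv: "matrix_inv M = ?N" by (intro matrix_inv_eqI)
  show "matrix_inv M ** M = mat 1" "M ** matrix_inv M = mat 1"
    unfolding inv by fact+
qed

lemma Ck_on_sv: "Ck_on k regular_GL (\<lambda>M :: ('f::rch_algebra, 'n::{finite,linorder}) sqmat. sv i M)"
  and Ck_on_spectral_proj: "Ck_on k regular_GL (spectral_proj i :: ('f::rch_algebra, 'n::{finite,linorder}) sqmat \<Rightarrow> _)"
  using Ck_on_sv_spectral_proj by blast+

lemma riemannian_metric_GL:
  "riemannian_metric_on regular_GL (GL_metric :: ('f::rch_algebra, 'n::{finite,linorder}) sqmat metric)"
  unfolding riemannian_metric_on_def
proof (intro conjI ballI allI impI open_regular_GL)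
  fix M u v :: "('f, 'n) sqmat" assume M: "M \<in> regular_GL"
  show "bilinear (GL_metric M)"
    unfolding bilinear_def by (auto intro!: linearI
      simp: GL_metric_eq matmul.add_right matmul.scaleR_right inner_add_left inner_add_right)
  show "GL_metric M u v = GL_metric M v u"
    by (simp add: GL_metric_eq inner_commute)
  show "0 < GL_metric M u u" if "u \<noteq> 0"
  proof -
    have "M ** (matrix_inv M ** u) = u"
      by (simp add: matrix_mul_assoc matrix_inv_regular(3)[OF M])
    then have "matrix_inv M ** u \<noteq> 0" using that by auto
    then show ?thesis by (simp add: GL_metric_eq)
  qed
next
  fix u v :: "('f, 'n) sqmat"
  have inv: "Ck_on k regular_GL (matrix_inv :: ('f, 'n) sqmat \<Rightarrow> ('f, 'n) sqmat)" for k
  proof -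
    let ?N = "\<lambda>M :: ('f, 'n) sqmat. \<Sum>i\<in>UNIV. inverse (sv i M * sv i M) *\<^sub>R (spectral_proj i M ** ctranspose M)"
    have "Ck_on k regular_GL ?N"
      by (intro Ck_on_regular_intros Ck_on_sv Ck_on_spectral_proj)
        (use sv_pos[where 'f = 'f and 'n = 'n] in \<open>simp add: less_imp_neq[symmetric]\<close>)
    moreover have "?N M = matrix_inv M" if "M \<in> regular_GL" for M
      by (simp only: matrix_inv_regular(1)[OF that] power2_eq_square)
    ultimately show ?thesis
      using Ck_on_cong[OF open_regular_GL, of ?N matrix_inv k] by blast
  qed
  show "smooth_on regular_GL (\<lambda>x. GL_metric x u v)"
    unfolding smooth_on_def GL_metric_eq by (intro allI Ck_on_regular_intros inv)
qed

definition d_quotient_map ::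
    "('f::rch_algebra, 'n::{finite,linorder}) sqmat \<Rightarrow> ('f, 'n) sqmat \<Rightarrow> real^'n::{finite,linorder}"
  where "d_quotient_map x v = (\<chi> i. inner v (x ** spectral_proj i x) / sv i x)"

text \<open>The horizontal lift of \<open>d\<close>, see \<open>horizontal_lift_eq\<close>. For \<open>x = U \<Sigma> V\<^sup>*\<close> it is \<open>U diag(d) V\<^sup>*\<close>.\<close>

definition spectral_lift ::
    "('f::rch_algebra, 'n::{finite,linorder}) sqmat \<Rightarrow> real^'n::{finite,linorder} \<Rightarrow> ('f, 'n) sqmat"
  where "spectral_lift x d = (\<Sum>i\<in>UNIV. (d $ i / sv i x) *\<^sub>R (x ** spectral_proj i x))"

lemma quotient_map_expansion: "quotient_map_in_chart x = (\<Sum>i\<in>UNIV. sv i x *\<^sub>R axis i 1)"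
  by (simp add: vec_eq_iff axis_def if_distrib cong: if_cong)

lemma smooth_on_quotient_map:
  "smooth_on regular_GL (quotient_map_in_chart :: ('f::rch_algebra, 'n::{finite,linorder}) sqmat \<Rightarrow> _)"
proof -
  have "Ck_on k regular_GL (\<lambda>x :: ('f, 'n) sqmat. \<Sum>i\<in>UNIV. sv i x *\<^sub>R (axis i 1 :: (real, 'n) vec))" for k
    by (intro Ck_on_regular_intros Ck_on_sv)
  then show ?thesis by (simp add: smooth_on_def flip: quotient_map_expansion)
qed

lemma frechet_derivative_quotient_map:
  fixes x :: "('f::rch_algebra, 'n::{finite,linorder}) sqmat"
  assumes x: "x \<in> regular_GL"
  shows "frechet_derivative quotient_map_in_chart (at x) = d_quotient_map x"
proof -
  have "((\<lambda>M. \<Sum>i\<in>UNIV. sv i M *\<^sub>R (axis i 1 :: (real, 'n) vec)) has_derivative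
      (\<lambda>v. \<Sum>i\<in>UNIV. (inner v (x ** spectral_proj i x) / sv i x) *\<^sub>R axis i 1)) (at x)"
    by (intro has_derivative_sum has_derivative_scaleR_left has_derivative_sv[OF x])
  moreover have "(\<lambda>v. \<Sum>i\<in>UNIV. (inner v (x ** spectral_proj i x) / sv i x) *\<^sub>R axis i 1) = d_quotient_map x"
    by (simp add: fun_eq_iff d_quotient_map_def vec_eq_iff axis_def if_distrib cong: if_cong)
  moreover have "(\<lambda>M. \<Sum>i\<in>UNIV. sv i M *\<^sub>R axis i 1) = (quotient_map_in_chart :: ('f, 'n) sqmat \<Rightarrow> _)"
    by (rule ext) (rule quotient_map_expansion[symmetric])
  ultimately have "(quotient_map_in_chart has_derivative d_quotient_map x) (at x)"
    by (simp only:)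
  then show ?thesis by (rule frechet_derivative_at[symmetric])
qed

lemma linear_d_quotient_map: "linear (d_quotient_map x)"
  by (rule linearI) (simp_all add: d_quotient_map_def vec_eq_iff inner_add_left add_divide_distrib)

context
  fixes x :: "('f::rch_algebra, 'n::{finite,linorder}) sqmat"
  assumes x: "x \<in> regular_GL"
begin

text \<open>The derivative in terms of the left translate of \<open>w\<close> to the identity, where the metric is the
  Euclidean one.\<close>

lemma d_quotient_map_nth:
  "d_quotient_map x w $ i = sv i x * inner (matrix_inv x ** w) (spectral_proj i x)"
proof -
  have "inner w (x ** spectral_proj i x) = inner (x ** (matrix_inv x ** w)) (x ** spectral_proj i x)"
    by (simp add: matrix_mul_assoc matrix_inv_regular(2,3)[OF x])
  also have "\<dots> = inner (matrix_inv x ** w) (ctranspose x ** x ** spectral_proj i x)"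
    using inner_matrix_mult_left[of x "matrix_inv x ** w" "x ** spectral_proj i x"]
    by (simp only: matrix_mul_assoc)
  also have "\<dots> = (sv i x)\<^sup>2 * inner (matrix_inv x ** w) (spectral_proj i x)"
    by (simp add: gram_spectral_proj[OF x])
  finally show ?thesis
    using sv_pos[OF x, of i] by (simp add: d_quotient_map_def power2_eq_square)
qed

lemma matrix_inv_lift: "matrix_inv x ** spectral_lift x d = (\<Sum>i\<in>UNIV. (d $ i / sv i x) *\<^sub>R spectral_proj i x)"
  by (simp add: spectral_lift_def matmul.sum_right matmul.scaleR_right matrix_mul_assoc matrix_inv_regular(2,3)[OF x])

lemma d_quotient_map_lift: "d_quotient_map x (spectral_lift x d) = d"
  using sv_pos[OF x]
  by (simp add: vec_eq_iff d_quotient_map_nth matrix_inv_lift inner_sum_left inner_spectral_proj[OF x]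
      if_distrib less_imp_neq[symmetric] cong: if_cong)

text \<open>The one formula behind the submersion property: against a lift, the metric sees only the image of
  the other vector under the derivative of the quotient map.\<close>

lemma GL_metric_lift:
  "GL_metric x (spectral_lift x d) w = (\<Sum>i\<in>UNIV. d $ i * d_quotient_map x w $ i / (sv i x)\<^sup>2)"
proof -
  have "GL_metric x (spectral_lift x d) w = (\<Sum>i\<in>UNIV. d $ i / sv i x * inner (spectral_proj i x) (matrix_inv x ** w))"
    by (simp add: GL_metric_eq matrix_inv_lift inner_sum_left)
  also have "\<dots> = (\<Sum>i\<in>UNIV. d $ i * d_quotient_map x w $ i / (sv i x)\<^sup>2)"
  proof (rule sum.cong[OF refl])
    fix i
    show "d $ i / sv i x * inner (spectral_proj i x) (matrix_inv x ** w) = d $ i * d_quotient_map x w $ i / (sv i x)\<^sup>2"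
      using sv_pos[OF x, of i] by (simp add: d_quotient_map_nth power2_eq_square inner_commute)
  qed
  finally show ?thesis .
qed

text \<open>Lifts are orthogonal to the kernel by the previous formula. Conversely, the difference of a
  horizontal vector and the lift of its image is both horizontal and in the kernel, so it has length
  zero.\<close>

lemma horizontal_space_iff:
  "u \<in> horizontal_space GL_metric quotient_map_in_chart x \<longleftrightarrow> u = spectral_lift x (d_quotient_map x u)"
proof -
  have bil: "bilinear (GL_metric x)" and pos: "u \<noteq> 0 \<Longrightarrow> 0 < GL_metric x u u" for u
    using riemannian_metric_GL x unfolding riemannian_metric_on_def by blast+
  have lift: "d_quotient_map x w = 0 \<Longrightarrow> GL_metric x (spectral_lift x d) w = 0" for d w
    by (simp add: GL_metric_lift)
  have "u = spectral_lift x (d_quotient_map x u)" if u: "\<And>w. d_quotient_map x w = 0 \<Longrightarrow> GL_metric x u w = 0"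
  proof -
    let ?w = "u - spectral_lift x (d_quotient_map x u)"
    have w: "d_quotient_map x ?w = 0"
      by (simp add: linear_diff[OF linear_d_quotient_map] d_quotient_map_lift)
    then have "GL_metric x ?w ?w = 0"
      by (simp add: u lift bilinear_lsub[OF bil])
    then show ?thesis using pos[of ?w] by fastforce
  qed
  moreover have "GL_metric x u w = 0" if "u = spectral_lift x (d_quotient_map x u)" "d_quotient_map x w = 0" for w
    using lift[OF that(2)] that(1) by metis
  ultimately show ?thesis
    unfolding horizontal_space_def frechet_derivative_quotient_map[OF x] by blast
qed

lemma horizontal_lift_eq: "horizontal_lift GL_metric quotient_map_in_chart x d = spectral_lift x d"
  unfolding horizontal_lift_def
proof (rule the_equality)
  show "spectral_lift x d \<in> horizontal_space GL_metric quotient_map_in_chart x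
      \<and> frechet_derivative quotient_map_in_chart (at x) (spectral_lift x d) = d"
    by (simp add: horizontal_space_iff frechet_derivative_quotient_map[OF x] d_quotient_map_lift)
next
  fix u
  assume "u \<in> horizontal_space GL_metric quotient_map_in_chart x
      \<and> frechet_derivative quotient_map_in_chart (at x) u = d"
  then show "u = spectral_lift x d"
    unfolding horizontal_space_iff frechet_derivative_quotient_map[OF x] by metis
qed

end

text \<open>The pullback of the Euclidean metric by the coordinatewise logarithm.\<close>

definition scale_invariant_metric :: "(real^'n) metric"
  where "scale_invariant_metric \<sigma> d1 d2 = (\<Sum>i\<in>UNIV. d1 $ i * d2 $ i / (\<sigma> $ i)\<^sup>2)"

lemma quotient_metric_eq:
  assumes \<sigma>: "\<sigma> \<in> weyl_chamber"
  shows "quotient_metric (regular_GL :: ('f::rch_algebra, 'n::{finite,linorder}) sqmat set)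
     GL_metric quotient_map_in_chart \<sigma> d1 d2 = scale_invariant_metric \<sigma> d1 d2"
proof -
  have fibre: "GL_metric x (horizontal_lift GL_metric quotient_map_in_chart x d1)
       (horizontal_lift GL_metric quotient_map_in_chart x d2) = scale_invariant_metric \<sigma> d1 d2"
    if "x \<in> regular_GL" "quotient_map_in_chart x = \<sigma>" for x :: "('f, 'n) sqmat"
    using that by (simp add: horizontal_lift_eq GL_metric_lift d_quotient_map_lift scale_invariant_metric_def)
  show ?thesis
    unfolding quotient_metric_def
  proof (rule the_equality)
    fix r
    \<comment> \<open>The fibre is not empty: it contains the diagonal matrix.\<close>
    assume "\<forall>x\<in>regular_GL. quotient_map_in_chart x = \<sigma> \<longrightarrow>
      r = GL_metric (x :: ('f, 'n) sqmat) (horizontal_lift GL_metric quotient_map_in_chart x d1)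
        (horizontal_lift GL_metric quotient_map_in_chart x d2)"
    then show "r = scale_invariant_metric \<sigma> d1 d2"
      using fibre diag_mat_regular[OF \<sigma>] quotient_map_diag_mat[OF \<sigma>] by metis
  qed (simp add: fibre)
qed

lemma scale_invariant_metric_trace:
  fixes \<sigma> d1 d2 :: "real^'n::{finite,linorder}"
  assumes "\<sigma> \<in> weyl_chamber"
  shows "scale_invariant_metric \<sigma> d1 d2 =
    trace (matrix_inv (diag_mat \<sigma>) ** diag_mat d1 ** diag_mat d2 ** matrix_inv (diag_mat \<sigma>))"
proof -
  have pos: "0 < \<sigma> $ i" for i using assms by (simp add: weyl_chamber_def)
  have "matrix_inv (diag_mat \<sigma> :: (real, 'n) sqmat) = diag_mat (\<chi> i. inverse (\<sigma> $ i))"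
    using pos by (intro matrix_inv_eqI) (simp_all add: diag_mat_mult less_imp_neq[symmetric] flip: diag_mat_one)
  then show ?thesis
    by (simp add: diag_mat_mult trace_def diag_mat_nth scale_invariant_metric_def power2_eq_square field_simps)
qed

lemma riemannian_metric_log:
  "riemannian_metric_on (weyl_chamber :: (real^'n::{finite,linorder}) set) scale_invariant_metric"
  unfolding riemannian_metric_on_def
proof (intro conjI ballI allI impI open_weyl_chamber)
  fix \<sigma> u v :: "real^'n::{finite,linorder}" assume \<sigma>: "\<sigma> \<in> weyl_chamber"
  have pos: "0 < \<sigma> $ i" for i using \<sigma> by (simp add: weyl_chamber_def)
  show "bilinear (scale_invariant_metric \<sigma>)"
    unfolding bilinear_def by (auto intro!: linearI simp: scale_invariant_metric_def algebra_simps add_divide_distrib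
      sum.distrib sum_distrib_left)
  show "scale_invariant_metric \<sigma> u v = scale_invariant_metric \<sigma> v u" by (simp add: scale_invariant_metric_def mult.commute)
  show "0 < scale_invariant_metric \<sigma> u u" if "u \<noteq> 0"
  proof -
    from that obtain i where i: "u $ i \<noteq> 0" by (auto simp: vec_eq_iff)
    have "0 < u $ i * u $ i" using i by (auto simp: zero_less_mult_iff linorder_neq_iff)
    then have "0 < u $ i * u $ i / (\<sigma> $ i)\<^sup>2" using pos[of i] by simp
    then show ?thesis unfolding scale_invariant_metric_def by (intro sum_pos2[of _ i]) auto
  qed
next
  fix u v :: "real^'n::{finite,linorder}"
  note intros = Ck_on_const Ck_on_sum[OF open_weyl_chamber] Ck_on_inverse[OF open_weyl_chamber]
    Ck_on_bilinear[OF bounded_bilinear_mult open_weyl_chamber]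
    Ck_on_bounded_linear[OF bounded_linear_vec_nth open_weyl_chamber] Ck_on_ident[OF open_weyl_chamber]
  show "smooth_on weyl_chamber (\<lambda>\<sigma>. scale_invariant_metric \<sigma> u v)"
    unfolding smooth_on_def scale_invariant_metric_def divide_inverse power2_eq_square
    by (intro allI intros) (auto simp: weyl_chamber_def less_imp_neq[symmetric])
qed

lemma riemannian_metric_on_cong:
  assumes "\<And>x u v. x \<in> S \<Longrightarrow> g x u v = h x u v" and h: "riemannian_metric_on S h"
  shows "riemannian_metric_on S g"
proof -
  have S: "open S" using h by (simp add: riemannian_metric_on_def)
  have "x \<in> S \<Longrightarrow> g x = h x" for x by (simp add: fun_eq_iff assms(1))
  moreover have "smooth_on S (\<lambda>x. g x u v)" for u v
    using h Ck_on_cong[OF S, of "\<lambda>x. g x u v" "\<lambda>x. h x u v"] assms(1)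
    by (simp add: riemannian_metric_on_def smooth_on_def)
  ultimately show ?thesis using h by (simp add: riemannian_metric_on_def)
qed

lemma riemannian_submersion_quotient_map:
  "riemannian_submersion (regular_GL :: ('f::rch_algebra, 'n::{finite,linorder}) sqmat set) GL_metric weyl_chamber
    (quotient_metric (regular_GL :: ('f, 'n) sqmat set) GL_metric quotient_map_in_chart) quotient_map_in_chart"
  (is "riemannian_submersion ?G _ _ ?h ?\<phi>")
  unfolding riemannian_submersion_def
proof (intro conjI ballI)
  show "riemannian_metric_on ?G GL_metric" by (rule riemannian_metric_GL)
  show "riemannian_metric_on weyl_chamber ?h"
    by (rule riemannian_metric_on_cong[OF quotient_metric_eq riemannian_metric_log])
  show "?\<phi> ` ?G \<subseteq> weyl_chamber" using quotient_map_svd(1) by blast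
  show "smooth_on ?G ?\<phi>" by (rule smooth_on_quotient_map)
  fix x assume x: "x \<in> ?G"
  note D = frechet_derivative_quotient_map[OF x]
  show "surj (frechet_derivative ?\<phi> (at x))"
    unfolding D using d_quotient_map_lift[OF x] by (rule surjI)
  fix u v assume u: "u \<in> horizontal_space GL_metric ?\<phi> x"
  have "GL_metric x u v = scale_invariant_metric (?\<phi> x) (d_quotient_map x u) (d_quotient_map x v)"
    using GL_metric_lift[OF x, of "d_quotient_map x u" v] u
    by (simp add: horizontal_space_iff[OF x] scale_invariant_metric_def)
  then show "?h (?\<phi> x) (frechet_derivative ?\<phi> (at x) u) (frechet_derivative ?\<phi> (at x) v) = GL_metric x u v"
    by (simp add: D quotient_metric_eq[OF quotient_map_svd(1)[OF x]])
qed

theorem proposition2p8: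
  fixes G :: "('f::rch_algebra^'n::{finite,linorder}^'n::{finite,linorder}) set"
    and \<phi> :: "'f^'n::{finite,linorder}^'n::{finite,linorder} \<Rightarrow> real^'n::{finite,linorder}"
    and chart :: "real^'n::{finite,linorder} \<Rightarrow> ('f^'n::{finite,linorder}^'n::{finite,linorder}) set"
    and h :: "(real^'n::{finite,linorder}) metric"
  defines "G \<equiv> regular_GL"
    and "\<phi> \<equiv> quotient_map_in_chart"
    and "chart \<equiv> weyl_chart"
    and "h \<equiv> quotient_metric G GL_metric \<phi>"
  shows "open G
    \<and> homeomorphic_map (top_of_set weyl_chamber) (quotient_topology G unitary_orbit) chart
    \<and> (\<forall>\<sigma>\<in>weyl_chamber. \<forall>M\<in>chart \<sigma>. singular_values M \<sigma>)
    \<and> riemannian_submersion G GL_metric weyl_chamber h \<phi>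
    \<and> (\<forall>\<sigma>\<in>weyl_chamber. \<forall>d1 d2.
         h \<sigma> d1 d2 =
           trace (matrix_inv (diag_mat \<sigma>) ** diag_mat d1 ** diag_mat d2 ** matrix_inv (diag_mat \<sigma>)))"
proof (intro conjI ballI allI)
  show "open G" unfolding G_def by (rule open_regular_GL)
  show "homeomorphic_map (top_of_set weyl_chamber) (quotient_topology G unitary_orbit) chart"
    unfolding G_def chart_def by (rule homeomorphic_weyl_chart)
  show "riemannian_submersion G GL_metric weyl_chamber h \<phi>"
    unfolding G_def \<phi>_def h_def by (rule riemannian_submersion_quotient_map)
next
  fix \<sigma> :: "real^'n::{finite,linorder}" and M :: "('f, 'n) sqmat"
  assume \<sigma>: "\<sigma> \<in> weyl_chamber" and "M \<in> chart \<sigma>"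
  then obtain U V where "is_svd U V \<sigma> M" unfolding chart_def by (elim weyl_chartE)
  then show "singular_values M \<sigma>"
    using \<sigma> weyl_chamber_subset_closed closed_weyl_chamber_nonneg by (blast intro: singular_values_of_svd)
next
  fix \<sigma> d1 d2 :: "real^'n::{finite,linorder}" assume "\<sigma> \<in> weyl_chamber"
  then show "h \<sigma> d1 d2 =
      trace (matrix_inv (diag_mat \<sigma>) ** diag_mat d1 ** diag_mat d2 ** matrix_inv (diag_mat \<sigma>))"
    unfolding h_def G_def \<phi>_def by (simp add: quotient_metric_eq scale_invariant_metric_trace)
qed

end
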